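(* Let $g$ be a Gårding-Dirichlet polynomial of degree $N\ge1$ on $S(n)$ with Gårding cone $\Gamma$, and let $\gamma>0$ be a constant. The following are equivalent: (1) (Majorization of the determinant) $$n\,\gamma^{1/n}(\det A)^{1/n}\ \le\ g(A)^{1/N}\qquad\text{for all }A>0 .$$ (2) (Lower bound for the determinant of the gradient) $$D_B\,g^{1/N}>0\quad\text{and}\quad\gamma\ \le\ \det\bigl(D_B\,g^{1/N}\bigr)\qquad\text{for all }B\in\Gamma .$$
   Context: $S(n)$ is the space of real symmetric $n\times n$ matrices with inner product $\langle A,B\rangle=\mathrm{tr}(AB)$, and $A>0$ (resp. $A\ge0$) means positive definite (resp. semidefinite). A Gårding-Dirichlet polynomial (operator) of degree $N$ is a homogeneous real polynomial $g$ of degree $N$ on $S(n)$ such that $g(I)>0$, $t\mapsto g(tI+A)$ has all real roots for every $A\in S(n)$, and the Gårding cone $\Gamma$, i.e. the connected component of $\{g\ne0\}$ containing $I$ (an open convex cone), satisfies $\{A\ge0\}\subset\overline\Gamma$. For $B\in\Gamma$, $D_B\,g^{1/N}\in S(n)$ is the gradient of $g^{1/N}$ at $B$ with respect to the inner product $\langle A,B\rangle=\mathrm{tr}(AB)$ on $S(n)$. *)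

theory Defs
  imports "HOL-Analysis.Analysis"
begin

text \<open>The dimension is \<^term>\<open>n = CARD('n)\<close>; the space of symmetric matrices is a closed linear
  subspace of \<^typ>\<open>real ^ 'n ^ 'n\<close>. Functions on that subspace are modelled by functions on the whole
  matrix type of which only the values at symmetric matrices are ever used.\<close>

definition sym_mats :: "(real ^ 'n ^ 'n) set" where
  "sym_mats = {A. transpose A = A}"

definition pos_def :: "real ^ 'n ^ 'n \<Rightarrow> bool" where
  "pos_def A \<longleftrightarrow> A \<in> sym_mats \<and> (\<forall>x. x \<noteq> 0 \<longrightarrow> x \<bullet> (A *v x) > 0)"

definition pos_semidef :: "real ^ 'n ^ 'n \<Rightarrow> bool" where
  "pos_semidef A \<longleftrightarrow> A \<in> sym_mats \<and> (\<forall>x. x \<bullet> (A *v x) \<ge> 0)"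

definition homogeneous_poly_on_sym :: "nat \<Rightarrow> (real ^ 'n ^ 'n \<Rightarrow> real) \<Rightarrow> bool" where
  "homogeneous_poly_on_sym N g \<longleftrightarrow>
     (\<exists>p. real_polynomial_function p \<and> (\<forall>A\<in>sym_mats. g A = p A)) \<and>
     (\<forall>A\<in>sym_mats. \<forall>t. g (t *\<^sub>R A) = t ^ N * g A)"

definition all_roots_real :: "real poly \<Rightarrow> bool" where
  "all_roots_real p \<longleftrightarrow> (\<forall>z::complex. poly (map_poly of_real p) z = 0 \<longrightarrow> z \<in> \<real>)"

definition garding_cone :: "(real ^ 'n ^ 'n \<Rightarrow> real) \<Rightarrow> (real ^ 'n ^ 'n) set" where
  "garding_cone g = connected_component_set {A \<in> sym_mats. g A \<noteq> 0} (mat 1)"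

text \<open>In the third clause the polynomial \<^term>\<open>q\<close> is determined by \<^term>\<open>g\<close> and \<^term>\<open>A\<close>, and it
  exists for every polynomial \<^term>\<open>g\<close>.  In the last clause the closure may be taken in the whole
  matrix space because the symmetric matrices form a closed subspace.\<close>

definition garding_dirichlet :: "nat \<Rightarrow> (real ^ 'n ^ 'n \<Rightarrow> real) \<Rightarrow> bool" where
  "garding_dirichlet N g \<longleftrightarrow>
     homogeneous_poly_on_sym N g \<and>
     g (mat 1) > 0 \<and>
     (\<forall>A\<in>sym_mats. \<exists>q. (\<forall>t. poly q t = g (t *\<^sub>R mat 1 + A)) \<and> all_roots_real q) \<and>
     {A. pos_semidef A} \<subseteq> closure (garding_cone g)"

text \<open>The gradient of \<^term>\<open>f\<close>, regarded as a function on the symmetric matrices only (hence the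
  derivative within \<^term>\<open>sym_mats\<close>), with respect to the inner product given by the trace of the
  product.\<close>

definition has_sym_gradient ::
    "(real ^ 'n ^ 'n \<Rightarrow> real) \<Rightarrow> real ^ 'n ^ 'n \<Rightarrow> real ^ 'n ^ 'n \<Rightarrow> bool" where
  "has_sym_gradient f D B \<longleftrightarrow>
     D \<in> sym_mats \<and> (f has_derivative (\<lambda>H. trace (D ** H))) (at B within sym_mats)"

definition sym_gradient :: "(real ^ 'n ^ 'n \<Rightarrow> real) \<Rightarrow> real ^ 'n ^ 'n \<Rightarrow> real ^ 'n ^ 'n" where
  "sym_gradient f B = (THE D. has_sym_gradient f D B)"

lemma sym_gradient_unique:
  fixes f :: "real ^ 'n ^ 'n \<Rightarrow> real"
  assumes B: "B \<in> sym_mats" and D: "has_sym_gradient f D B" and D': "has_sym_gradient f D' B"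
  shows "D = D'"
proof -
  define E where "E = D - D'"
  have Es: "transpose E = E"
    using D D' by (auto simp: E_def has_sym_gradient_def sym_mats_def transpose_def vec_eq_iff)
  define c :: "real \<Rightarrow> real ^ 'n ^ 'n" where "c = (\<lambda>t. B + t *\<^sub>R E)"
  have cS: "c t \<in> sym_mats" for t
    using B Es by (auto simp: c_def sym_mats_def transpose_def vec_eq_iff)
  have cd: "(c has_derivative (\<lambda>t. t *\<^sub>R E)) (at 0)"
    unfolding c_def by (auto intro!: derivative_eq_intros)
  have *: "((\<lambda>t. f (c t)) has_derivative (\<lambda>t. trace (X ** (t *\<^sub>R E)))) (at 0)"
    if "has_sym_gradient f X B" for X
  proof -
    have "(f has_derivative (\<lambda>H. trace (X ** H))) (at (c 0) within range c)"
      using that cS by (auto simp: has_sym_gradient_def c_def intro: has_derivative_subset)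
    then show ?thesis
      using has_derivative_in_compose[OF cd] by simp
  qed
  have "(\<lambda>t. trace (D ** (t *\<^sub>R E))) = (\<lambda>t. trace (D' ** (t *\<^sub>R E)))"
    using has_derivative_unique[OF *[OF D] *[OF D']] .
  from fun_cong[OF this, of 1] have "trace (D ** E) = trace (D' ** E)" by simp
  moreover have "trace (E ** E) = trace (D ** E) - trace (D' ** E)"
    by (simp add: E_def trace_def matrix_matrix_mult_def sum_subtractf[symmetric] algebra_simps)
  ultimately have "trace (E ** E) = 0" by simp
  moreover have "E $ j $ i = E $ i $ j" for i j
    using arg_cong[OF Es, of "\<lambda>M. M $ i $ j"] by (simp add: transpose_def)
  ultimately have "(\<Sum>i\<in>UNIV. \<Sum>j\<in>UNIV. (E $ i $ j)\<^sup>2) = 0"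
    by (simp add: trace_def matrix_matrix_mult_def power2_eq_square)
  then have "E = 0"
    by (simp add: sum_nonneg_eq_0_iff sum_nonneg vec_eq_iff)
  then show ?thesis by (simp add: E_def)
qed

lemma sym_gradient_eqI:
  assumes "B \<in> sym_mats" "has_sym_gradient f D B"
  shows "sym_gradient f B = D"
  unfolding sym_gradient_def using assms sym_gradient_unique by blast

end

theory Submission
  imports Defs "HOL-Computational_Algebra.Fundamental_Theorem_Algebra"
begin

text \<open>
  Everything rests on one inequality. For \<open>B\<close> in the cone and \<open>A > 0\<close>, the number
  \<open>g(A)\<^sup>1\<^sup>/\<^sup>N\<close> is at most the derivative of \<open>g\<^sup>1\<^sup>/\<^sup>N\<close> at \<open>B\<close> in the direction \<open>A\<close>, that is
  \<open>g(A)\<^sup>1\<^sup>/\<^sup>N \<le> trace(D A)\<close> where \<open>D\<close> is the gradient at \<open>B\<close>; when \<open>A = B\<close> there is equality, by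
  Euler's identity.

  The inequality is the comparison of arithmetic and geometric means for the roots of \<open>g\<close> along a
  line. By Garding's theorem (\<open>hyperbolic_on_cone\<close>), \<open>g\<close> is hyperbolic not only in the
  direction \<open>I\<close> but in the direction of every \<open>B\<close> in the cone, so
  \<open>g(A + t B) = g(B) (t + r\<^sub>1) \<cdots> (t + r\<^sub>N)\<close> with real \<open>r\<^sub>i\<close>, all positive because the cone is the
  same for \<open>B\<close> as for \<open>I\<close>. With \<open>b = g(B)\<^sup>1\<^sup>/\<^sup>N\<close>, the geometric mean of the \<open>r\<^sub>i\<close> is
  \<open>g(A)\<^sup>1\<^sup>/\<^sup>N / b\<close>, and their arithmetic mean is \<open>1/b\<close> times the directional derivative
  (\<open>hyperbolic_root_le_derivative\<close>).

  The same theory applies to the polynomial \<open>det\<close>, which is hyperbolic in the direction \<open>I\<close> because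
  symmetric matrices have real eigenvalues. At \<open>B = D\<^sup>-\<^sup>1\<close> the inequality becomes
  \<open>n (det D)\<^sup>1\<^sup>/\<^sup>n (det A)\<^sup>1\<^sup>/\<^sup>n \<le> trace(D A)\<close> for \<open>A, D > 0\<close> (\<open>trace_det_arith_geom_mean\<close>).

  From the lower bound on gradients to majorization: for \<open>A > 0\<close> let \<open>D\<close> be the gradient at \<open>A\<close>
  itself; then \<open>g(A)\<^sup>1\<^sup>/\<^sup>N = trace(D A) \<ge> n (det D)\<^sup>1\<^sup>/\<^sup>n (det A)\<^sup>1\<^sup>/\<^sup>n \<ge> n \<gamma>\<^sup>1\<^sup>/\<^sup>n (det A)\<^sup>1\<^sup>/\<^sup>n\<close>.

  Conversely, majorization gives \<open>n \<gamma>\<^sup>1\<^sup>/\<^sup>n (det A)\<^sup>1\<^sup>/\<^sup>n \<le> trace(D A)\<close> for all \<open>A > 0\<close> and every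
  gradient \<open>D\<close>. If \<open>D > 0\<close>, the choice \<open>A = D\<^sup>-\<^sup>1\<close> yields \<open>\<gamma> \<le> det D\<close>. In general \<open>D \<ge> 0\<close>, because
  its trace form is nonnegative on positive definite matrices; one takes \<open>A = (D + \<epsilon> I)\<^sup>-\<^sup>1\<close> and
  lets \<open>\<epsilon>\<close> tend to \<open>0\<close>, and then \<open>det D \<ge> \<gamma> > 0\<close> excludes a kernel
  (\<open>pos_def_and_det_ge_if_trace_ge\<close>).
\<close>

section \<open>Polynomials on the complexification of a real vector space\<close>

text \<open>A pair \<open>(X, Y)\<close> stands for the point \<open>X + i Y\<close> of the complexified space.\<close>
definition cscale :: "complex \<Rightarrow> 'a \<times> 'a \<Rightarrow> 'a \<times> 'a::real_vector" where
  "cscale w Z = (Re w *\<^sub>R fst Z - Im w *\<^sub>R snd Z, Re w *\<^sub>R snd Z + Im w *\<^sub>R fst Z)"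

text \<open>Only two features of complex polynomial functions are used: continuity, and that the restriction
  to every complex line is a polynomial in one variable.\<close>
definition complex_poly :: "('a::real_normed_vector \<times> 'a \<Rightarrow> complex) \<Rightarrow> bool" where
  "complex_poly G \<longleftrightarrow> continuous_on UNIV G \<and> (\<forall>Z W. \<exists>q. \<forall>w. G (Z + cscale w W) = poly q w)"

lemma continuous_on_complex_poly:
  assumes "complex_poly G" "continuous_on T h"
  shows "continuous_on T (\<lambda>x. G (h x))"
  using assms unfolding complex_poly_def
  by (intro continuous_on_compose2[of UNIV G T h]) auto

lemma complex_poly_const: "complex_poly (\<lambda>_. c)"
  unfolding complex_poly_def by (auto intro!: exI[of _ "[:c:]"])

lemma complex_poly_add:
  assumes "complex_poly F" "complex_poly G"
  shows "complex_poly (\<lambda>Z. F Z + G Z)"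
  unfolding complex_poly_def
proof (intro conjI allI)
  show "continuous_on UNIV (\<lambda>Z. F Z + G Z)"
    using assms unfolding complex_poly_def by (auto intro!: continuous_on_add)
next
  fix Z W
  obtain p q where "\<And>w. F (Z + cscale w W) = poly p w" "\<And>w. G (Z + cscale w W) = poly q w"
    using assms unfolding complex_poly_def by meson
  then show "\<exists>q. \<forall>w. F (Z + cscale w W) + G (Z + cscale w W) = poly q w"
    by (intro exI[of _ "p + q"]) simp
qed

lemma complex_poly_mult:
  assumes "complex_poly F" "complex_poly G"
  shows "complex_poly (\<lambda>Z. F Z * G Z)"
  unfolding complex_poly_def
proof (intro conjI allI)
  show "continuous_on UNIV (\<lambda>Z. F Z * G Z)"
    using assms unfolding complex_poly_def by (auto intro!: continuous_on_mult)
next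
  fix Z W
  obtain p q where "\<And>w. F (Z + cscale w W) = poly p w" "\<And>w. G (Z + cscale w W) = poly q w"
    using assms unfolding complex_poly_def by meson
  then show "\<exists>q. \<forall>w. F (Z + cscale w W) * G (Z + cscale w W) = poly q w"
    by (intro exI[of _ "p * q"]) simp
qed

lemma real_polynomial_function_complexify:
  fixes p :: "'a::real_normed_vector \<Rightarrow> real"
  assumes "real_polynomial_function p"
  shows "\<exists>G. complex_poly G \<and> (\<forall>X. G (X, 0) = of_real (p X))"
  using assms
proof (induction rule: real_polynomial_function.induct)
  case (linear f)
  note bl = linear
  interpret bounded_linear f by fact
  define G where "G = (\<lambda>Z. of_real (f (fst Z)) + \<i> * of_real (f (snd Z)) :: complex)"
  have "continuous_on UNIV G"
    unfolding G_def
    by (intro continuous_intros bounded_linear.continuous_on[OF bl])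
  moreover have "G (Z + cscale w W) = poly [:G Z, G W:] w" for Z W w
    by (simp add: G_def cscale_def add diff scaleR complex_eq_iff algebra_simps)
  ultimately have "complex_poly G"
    unfolding complex_poly_def by blast
  moreover have "\<forall>X. G (X, 0) = of_real (f X)"
    by (simp add: G_def zero)
  ultimately show ?case by blast
next
  case (const c)
  show ?case by (intro exI[of _ "\<lambda>_. of_real c"]) (simp add: complex_poly_const)
next
  case (add f g)
  then obtain F G where "complex_poly F" "\<forall>X. F (X, 0) = of_real (f X)"
    "complex_poly G" "\<forall>X. G (X, 0) = of_real (g X)" by blast
  then show ?case
    by (intro exI[of _ "\<lambda>Z. F Z + G Z"]) (simp add: complex_poly_add)
next
  case (mult f g)
  then obtain F G where "complex_poly F" "\<forall>X. F (X, 0) = of_real (f X)"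
    "complex_poly G" "\<forall>X. G (X, 0) = of_real (g X)" by blast
  then show ?case
    by (intro exI[of _ "\<lambda>Z. F Z * G Z"]) (simp add: complex_poly_mult)
qed

lemma poly_eq_if_eq_on_reals:
  fixes p q :: "complex poly"
  assumes "\<And>t::real. poly p (of_real t) = poly q (of_real t)"
  shows "p = q"
proof (rule ccontr)
  assume "p \<noteq> q"
  then have "finite {z. poly (p - q) z = 0}"
    by (intro poly_roots_finite) simp
  moreover have "range (of_real :: real \<Rightarrow> complex) \<subseteq> {z. poly (p - q) z = 0}"
    using assms by auto
  ultimately have "finite (range (of_real :: real \<Rightarrow> complex))"
    by (rule finite_subset[rotated])
  then show False
    using finite_imageD[of "of_real :: real \<Rightarrow> complex" UNIV] by (simp add: inj_on_def infinite_UNIV_char_0)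
qed

text \<open>A point \<open>X + i Y\<close> lies on the complex line through \<open>X\<close> with real direction \<open>Y\<close>. The function
  vanishes at the real points of this line, hence on the whole line.\<close>
lemma complex_poly_zero:
  assumes G: "complex_poly G" and S: "subspace S"
    and zero: "\<And>X. X \<in> S \<Longrightarrow> G (X, 0) = 0" and Z: "Z \<in> S \<times> S"
  shows "G Z = 0"
proof -
  obtain X Y where Z_eq: "Z = (X, Y)" and XY: "X \<in> S" "Y \<in> S" using Z by auto
  obtain q where q: "\<And>w. G ((X, 0) + cscale w (Y, 0)) = poly q w"
    using G unfolding complex_poly_def by meson
  have "poly q (of_real t) = poly 0 (of_real t)" for t
    using zero[of "X + t *\<^sub>R Y"] q[of "of_real t"] XY S
    by (simp add: cscale_def subspace_add subspace_scale)
  then have "q = 0" by (rule poly_eq_if_eq_on_reals)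
  then show ?thesis
    using q[of \<i>] by (simp add: Z_eq cscale_def)
qed

lemma cscale_add: "cscale w (Z + W) = cscale w Z + cscale w W"
  by (simp add: cscale_def algebra_simps prod_eq_iff)

lemma cscale_cscale: "cscale v (cscale w Z) = cscale (v * w) Z"
  by (simp add: cscale_def algebra_simps prod_eq_iff)

lemma cscale_one [simp]: "cscale 1 Z = Z"
  and cscale_zero_left [simp]: "cscale 0 Z = 0"
  by (simp_all add: cscale_def prod_eq_iff)

lemma cscale_mem: "subspace S \<Longrightarrow> Z \<in> S \<times> S \<Longrightarrow> cscale w Z \<in> S \<times> S"
  by (auto simp: cscale_def subspace_add subspace_diff subspace_scale)

lemma add_mem_Times: "subspace S \<Longrightarrow> Z \<in> S \<times> S \<Longrightarrow> W \<in> S \<times> S \<Longrightarrow> Z + W \<in> S \<times> S"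
  by (auto simp: subspace_add)

lemma continuous_on_cscale [continuous_intros]:
  fixes h :: "'b::topological_space \<Rightarrow> 'a::real_normed_vector \<times> 'a"
  assumes "continuous_on T f" "continuous_on T h"
  shows "continuous_on T (\<lambda>x. cscale (f x) (h x))"
  unfolding cscale_def using assms by (intro continuous_intros)

text \<open>The constant is crude; only boundedness of the scaling matters for locating roots.\<close>
lemma norm_cscale_le:
  fixes Z :: "'a::real_normed_vector \<times> 'a"
  shows "norm (cscale w Z) \<le> 4 * cmod w * norm Z"
proof -
  have b: "\<bar>Re w\<bar> \<le> cmod w" "\<bar>Im w\<bar> \<le> cmod w" "norm (fst Z) \<le> norm Z" "norm (snd Z) \<le> norm Z"
    using abs_Re_le_cmod[of w] abs_Im_le_cmod[of w] norm_fst_le[of "fst Z" "snd Z"]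
      norm_snd_le[of "snd Z" "fst Z"] by auto
  have m: "norm (a *\<^sub>R x) \<le> cmod w * norm Z" if "\<bar>a\<bar> \<le> cmod w" "norm x \<le> norm Z" for a and x :: 'a
    using that by (simp add: mult_mono)
  have "norm (cscale w Z) \<le> norm (Re w *\<^sub>R fst Z - Im w *\<^sub>R snd Z) + norm (Re w *\<^sub>R snd Z + Im w *\<^sub>R fst Z)"
    unfolding cscale_def by (rule norm_Pair_le)
  also have "\<dots> \<le> (cmod w * norm Z + cmod w * norm Z) + (cmod w * norm Z + cmod w * norm Z)"
    by (intro add_mono order_trans[OF norm_triangle_ineq4] order_trans[OF norm_triangle_ineq] m b)
  finally show ?thesis by simp
qed

text \<open>Homogeneity passes from real to complex points in two steps: for a fixed real factor both sides
  are complex polynomials in the point, and then, for a fixed point, both sides are polynomials in the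
  factor.\<close>
lemma complex_poly_homogeneous:
  assumes G: "complex_poly G" and S: "subspace S"
    and hom: "\<And>X t. X \<in> S \<Longrightarrow> G (t *\<^sub>R X, 0) = of_real t ^ N * G (X, 0)"
    and Z: "Z \<in> S \<times> S"
  shows "G (cscale w Z) = w ^ N * G Z"
proof -
  have real: "G (cscale (of_real t) Z) = of_real t ^ N * G Z" for t
  proof -
    define H where "H = (\<lambda>Z. G (cscale (of_real t) Z) + (- (of_real t ^ N)) * G Z)"
    have "complex_poly (\<lambda>Z. G (cscale (of_real t) Z))"
      unfolding complex_poly_def
    proof (intro conjI allI)
      show "continuous_on UNIV (\<lambda>Z. G (cscale (complex_of_real t) Z))"
        by (intro continuous_on_complex_poly[OF G] continuous_on_cscale continuous_on_const continuous_on_id)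
    next
      fix U V
      obtain q where "\<And>w. G (cscale (of_real t) U + cscale w (cscale (of_real t) V)) = poly q w"
        using G unfolding complex_poly_def by meson
      then show "\<exists>q. \<forall>w. G (cscale (of_real t) (U + cscale w V)) = poly q w"
        by (auto simp: cscale_add cscale_cscale mult.commute)
    qed
    then have "complex_poly H"
      unfolding H_def by (intro complex_poly_add complex_poly_mult complex_poly_const G)
    moreover have "H (X, 0) = 0" if "X \<in> S" for X
      using hom[OF that, of t] by (simp add: H_def cscale_def)
    ultimately have "H Z = 0"
      by (rule complex_poly_zero[OF _ S _ Z])
    then show ?thesis by (simp add: H_def)
  qed
  obtain q where q: "\<And>w. G (0 + cscale w Z) = poly q w"
    using G unfolding complex_poly_def by meson
  have "q = monom (G Z) N"
    by (rule poly_eq_if_eq_on_reals) (use real q in \<open>simp add: poly_monom mult.commute\<close>)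
  then show ?thesis
    using q[of w] by (simp add: poly_monom mult.commute)
qed

text \<open>By homogeneity, \<open>w \<mapsto> G (Z + w W)\<close> is the reversal, as a polynomial of formal degree \<open>N\<close>, of
  \<open>u \<mapsto> G (W + u Z)\<close>, whose constant term is \<open>G W\<close>. So it has degree exactly \<open>N\<close> and leading
  coefficient \<open>G W\<close>.\<close>
lemma complex_poly_factorization:
  assumes G: "complex_poly G"
    and S: "subspace S" and hom: "\<And>Z w. Z \<in> S \<times> S \<Longrightarrow> G (cscale w Z) = w ^ N * G Z"
    and Z: "Z \<in> S \<times> S" and W: "W \<in> S \<times> S" "G W \<noteq> 0"
  obtains r :: "nat \<Rightarrow> complex" where "\<And>w. G (Z + cscale w W) = G W * (\<Prod>i<N. w - r i)"
proof -
  obtain q where q: "\<And>w. G (Z + cscale w W) = poly q w"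
    using G unfolding complex_poly_def by meson
  obtain p where p: "\<And>w. G (W + cscale w Z) = poly p w"
    using G unfolding complex_poly_def by meson
  have p0: "coeff p 0 = G W"
    using p[of 0] by (simp add: poly_0_coeff_0)
  have rev: "poly (monom 1 N * reflect_poly p) w = poly (monom 1 (degree p) * q) w" if "w \<noteq> 0" for w
  proof -
    have "poly q w = G (cscale w (W + cscale (inverse w) Z))"
      using that by (simp add: q[symmetric] cscale_add cscale_cscale add.commute)
    also have "\<dots> = w ^ N * poly p (inverse w)"
      using Z W S by (simp add: hom p add_mem_Times cscale_mem)
    finally show ?thesis
      using that by (simp add: poly_monom poly_reflect_poly_nz)
  qed
  have eq: "monom 1 N * reflect_poly p = monom 1 (degree p) * q"
  proof (rule ccontr)
    assume neq: "monom 1 N * reflect_poly p \<noteq> monom 1 (degree p) * q"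
    define d where "d = monom 1 N * reflect_poly p - monom 1 (degree p) * q"
    have "finite {z. poly d z = 0}"
      using neq by (intro poly_roots_finite) (simp add: d_def)
    moreover have "UNIV - {0} \<subseteq> {z. poly d z = 0}"
      using rev by (auto simp: d_def)
    ultimately have "finite (UNIV - {0::complex})"
      by (rule finite_subset[rotated])
    then show False
      by (simp add: infinite_UNIV_char_0)
  qed
  have nz: "q \<noteq> 0" "p \<noteq> 0"
    using eq W p0 by auto
  have "degree (monom 1 N * reflect_poly p) = degree (monom 1 (degree p) * q)"
    using eq by simp
  then have deg: "degree q = N"
    using nz W p0 by (simp add: degree_mult_eq degree_monom_eq)
  have "lead_coeff (monom 1 N * reflect_poly p) = lead_coeff (monom 1 (degree p) * q)"
    using eq by simp
  then have lead: "lead_coeff q = G W"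
    using W p0 unfolding lead_coeff_mult
    by (simp add: degree_monom_eq coeff_reflect_poly)
  obtain A where A: "size A = N" "q = smult (G W) (\<Prod>x\<in>#A. [:-x, 1:])"
    using alg_closed_imp_factorization[OF nz(1)] deg lead by auto
  obtain xs where xs: "mset xs = A" using ex_mset by blast
  have "poly q w = G W * (\<Prod>i<N. w - xs ! i)" for w
  proof -
    have "poly q w = G W * (\<Prod>x\<in>#A. w - x)"
      by (simp add: A(2) poly_prod_mset image_mset.compositionality o_def)
    also have "(\<Prod>x\<in>#A. w - x) = prod_list (map (\<lambda>x. w - x) xs)"
      by (simp add: xs[symmetric] prod_mset_prod_list flip: mset_map)
    also have "\<dots> = (\<Prod>i<N. w - xs ! i)"
      using A(1) xs by (auto simp: prod.list_conv_set_nth atLeast0LessThan)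
    finally show ?thesis .
  qed
  then show ?thesis
    using that[of "\<lambda>i. xs ! i"] q by simp
qed

section \<open>Continuity of roots\<close>

text \<open>Roots move continuously with the parameter \<open>s\<close>, so a root can enter the open upper half plane
  only through the real axis, which is forbidden for \<open>s < 1\<close>. The proof looks at the least \<open>s\<close> with
  a root in the closed upper half plane; the set of these parameters is compact because the roots stay
  bounded. At the least parameter there is a root \<open>w\<close> in the open half plane. For slightly smaller
  parameters the product of the distances from \<open>w\<close> to the roots is below \<open>(Im w)\<^sup>N\<close>, so some root is
  nearer to \<open>w\<close> than the real axis is and still lies in the upper half plane.\<close>
lemma no_roots_in_upper_half_plane:
  fixes Z :: "real \<Rightarrow> 'a::real_normed_vector \<times> 'a"
  assumes G: "complex_poly G" and S: "subspace S"
    and hom: "\<And>Z w. Z \<in> S \<times> S \<Longrightarrow> G (cscale w Z) = w ^ N * G Z"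
    and Z: "continuous_on {0..1} Z" "\<And>s. Z s \<in> S \<times> S"
    and W: "W \<in> S \<times> S" "G W \<noteq> 0"
    and no_real: "\<And>s t. 0 \<le> s \<Longrightarrow> s < 1 \<Longrightarrow> G (Z s + cscale (of_real t) W) \<noteq> 0"
    and start: "\<And>w. Im w > 0 \<Longrightarrow> G (Z 0 + cscale w W) \<noteq> 0"
    and w1: "Im w1 > 0"
  shows "G (Z 1 + cscale w1 W) \<noteq> 0"
proof
  assume root1: "G (Z 1 + cscale w1 W) = 0"
  \<comment> \<open>Parameters paired with roots in the closed half plane; closedness of the half plane is what
    makes \<open>K\<close> compact.\<close>
  define K where "K = {x \<in> {0..1} \<times> {w. Im w \<ge> 0}. G (Z (fst x) + cscale (snd x) W) = 0}"
  have "continuous_on ({0..1} \<times> {w. Im w \<ge> 0}) (\<lambda>x. G (Z (fst x) + cscale (snd x) W))"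
    by (intro continuous_on_complex_poly[OF G] continuous_on_add continuous_on_cscale
        continuous_on_const continuous_on_compose2[OF Z(1)] continuous_on_fst continuous_on_snd
        continuous_on_id) auto
  then have "closed K"
    unfolding K_def
    by (intro continuous_closed_preimage_constant closed_Times closed_halfspace_Im_ge) auto
  moreover have "bounded K"
  proof -
    have "compact (Z ` {0..1})"
      by (intro compact_continuous_image Z compact_Icc)
    then obtain C where C: "C > 0" "\<And>s. s \<in> {0..1} \<Longrightarrow> norm (Z s) \<le> C"
      using compact_imp_bounded[of "Z ` {0..1}"] unfolding bounded_pos by auto
    have "continuous_on UNIV G"
      using G by (simp add: complex_poly_def)
    then obtain d where d: "d > 0" "\<And>V. dist V W < d \<Longrightarrow> dist (G V) (G W) < cmod (G W)"
      using W(2) unfolding continuous_on_iff by (elim ballE[of _ _ W] allE[of _ "cmod (G W)"]) auto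
    \<comment> \<open>For large \<open>w\<close>, the point \<open>Z s + w W\<close> is \<open>w\<close> times a small perturbation of \<open>W\<close>.\<close>
    have "cmod w \<le> 4 * C / d" if s: "s \<in> {0..1}" and root: "G (Z s + cscale w W) = 0" for s w
    proof (rule ccontr)
      assume large: "\<not> cmod w \<le> 4 * C / d"
      then have w0: "w \<noteq> 0"
        using C(1) d(1) by auto
      have "norm (cscale (inverse w) (Z s)) \<le> 4 * cmod (inverse w) * C"
        using norm_cscale_le[of "inverse w" "Z s"] C(2)[OF s]
        by (meson mult_left_mono norm_ge_zero mult_nonneg_nonneg order_trans zero_le_numeral)
      also have "\<dots> < d"
        using large w0 d(1) by (simp add: norm_inverse norm_divide field_simps)
      finally have "G (cscale (inverse w) (Z s) + W) \<noteq> 0"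
        using d(2)[of "cscale (inverse w) (Z s) + W"] by (auto simp: dist_norm)
      moreover have "G (Z s + cscale w W) = w ^ N * G (cscale (inverse w) (Z s) + W)"
      proof -
        have "Z s + cscale w W = cscale w (cscale (inverse w) (Z s) + W)"
          using w0 by (simp add: cscale_add cscale_cscale)
        then show ?thesis
          using Z(2) W(1) S by (simp only: hom add_mem_Times cscale_mem)
      qed
      ultimately show False
        using root w0 by simp
    qed
    then have "K \<subseteq> {0..1} \<times> cball 0 (4 * C / d)"
      by (auto simp: K_def)
    then show ?thesis
      by (rule bounded_subset[rotated]) (intro bounded_Times bounded_cball bounded_closed_interval)
  qed
  ultimately have "compact K"
    by (simp add: compact_eq_bounded_closed)
  then have T: "compact (fst ` K)"
    by (intro compact_continuous_image continuous_on_fst continuous_on_id)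
  have "(1, w1) \<in> K"
    using root1 w1 by (simp add: K_def)
  then have ne: "fst ` K \<noteq> {}" by blast
  define m where "m = Inf (fst ` K)"
  have bdd: "bdd_below (fst ` K)"
    using T by (simp add: bounded_imp_bdd_below compact_imp_bounded)
  have "m \<in> fst ` K"
    unfolding m_def using T ne bdd by (intro closed_contains_Inf compact_imp_closed)
  then obtain w0 where w0: "m \<in> {0..1}" "Im w0 \<ge> 0" "G (Z m + cscale w0 W) = 0"
    by (auto simp: K_def)
  have m_min: "m \<le> s" if "(s, w) \<in> K" for s w
    unfolding m_def using that bdd by (intro cInf_lower) force+
  have real_or_upper: "Im w0 > 0" if "m < 1"
  proof (rule ccontr)
    assume "\<not> Im w0 > 0"
    then have "w0 = of_real (Re w0)"
      using w0(2) by (simp add: complex_eq_iff)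
    then show False
      using no_real[of m "Re w0"] w0 that by simp
  qed
  \<comment> \<open>For \<open>m = 1\<close> the root \<open>w0\<close> may be real, and \<open>w1\<close> takes its place.\<close>
  then obtain w where w: "Im w > 0" "G (Z m + cscale w W) = 0"
    using w0 w1 root1 by (cases "m = 1") auto
  have "m > 0"
    using start[OF w(1)] w(2) w0(1) by (cases "m = 0") auto
  have "continuous_on {0..1} (\<lambda>s. G (Z s + cscale w W))"
    by (intro continuous_on_complex_poly[OF G] continuous_on_add Z(1) continuous_on_const)
  moreover have pos: "cmod (G W) * Im w ^ N > 0"
    using W(2) w(1) by simp
  ultimately obtain d where d: "d > 0"
    "\<And>s. s \<in> {0..1} \<Longrightarrow> dist s m < d \<Longrightarrow> cmod (G (Z s + cscale w W)) < cmod (G W) * Im w ^ N"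
    using w0(1) w(2) unfolding continuous_on_iff by (fastforce simp: dist_norm)
  \<comment> \<open>The second argument of the minimum keeps \<open>s\<close> nonnegative.\<close>
  define s where "s = m - min (d / 2) m"
  have s: "s \<in> {0..1}" "s < m" "dist s m < d"
    using \<open>m > 0\<close> d(1) w0(1) by (auto simp: s_def dist_real_def)
  obtain r where r: "\<And>w. G (Z s + cscale w W) = G W * (\<Prod>i<N. w - r i)"
    using complex_poly_factorization[OF G S hom Z(2) W] by blast
  have "(\<Prod>i<N. cmod (w - r i)) < (\<Prod>i<N. Im w)"
    using d(2)[OF s(1,3)] W(2) by (simp add: r norm_mult prod_norm)
  then obtain i where i: "i < N" "cmod (w - r i) < Im w"
    using prod_mono[of "{..<N}" "\<lambda>_. Im w" "\<lambda>i. cmod (w - r i)"] w(1)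
    by (auto simp: not_less[symmetric])
  then have "Im (r i) > 0"
    using abs_Im_le_cmod[of "w - r i"] by simp
  moreover have "G (Z s + cscale (r i) W) = 0"
    using i(1) by (auto simp: r prod_zero_iff)
  ultimately have "(s, r i) \<in> K"
    using s(1) by (simp add: K_def)
  then show False
    using m_min s(2) by fastforce
qed

section \<open>Hyperbolic polynomials and Garding's theorem\<close>
definition homogeneous_poly_on :: "'a set \<Rightarrow> nat \<Rightarrow> ('a::real_normed_vector \<Rightarrow> real) \<Rightarrow> bool" where
  "homogeneous_poly_on S N g \<longleftrightarrow>
     (\<exists>p. real_polynomial_function p \<and> (\<forall>A\<in>S. g A = p A)) \<and>
     (\<forall>A\<in>S. \<forall>t. g (t *\<^sub>R A) = t ^ N * g A)"

definition complexifies :: "('a::real_normed_vector \<times> 'a \<Rightarrow> complex) \<Rightarrow> 'a set \<Rightarrow> nat \<Rightarrow> ('a \<Rightarrow> real) \<Rightarrow> bool" where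
  "complexifies G S N g \<longleftrightarrow> complex_poly G \<and> (\<forall>X\<in>S. G (X, 0) = of_real (g X)) \<and>
     (\<forall>Z\<in>S \<times> S. \<forall>w. G (cscale w Z) = w ^ N * G Z)"

lemma complexifies_poly: "complexifies G S N g \<Longrightarrow> complex_poly G"
  and complexifies_real: "complexifies G S N g \<Longrightarrow> X \<in> S \<Longrightarrow> G (X, 0) = of_real (g X)"
  and complexifies_homogeneous: "complexifies G S N g \<Longrightarrow> Z \<in> S \<times> S \<Longrightarrow> G (cscale w Z) = w ^ N * G Z"
  unfolding complexifies_def by blast+

lemma homogeneous_poly_complexify:
  assumes S: "subspace S" and g: "homogeneous_poly_on S N g"
  obtains G where "complexifies G S N g"
proof -
  obtain p where p: "real_polynomial_function p" "\<And>X. X \<in> S \<Longrightarrow> g X = p X"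
    using g unfolding homogeneous_poly_on_def by blast
  obtain G where G: "complex_poly G" "\<And>X. G (X, 0) = of_real (p X)"
    using real_polynomial_function_complexify[OF p(1)] by blast
  have "G (t *\<^sub>R X, 0) = of_real t ^ N * G (X, 0)" if "X \<in> S" for X t
    using g that S unfolding homogeneous_poly_on_def
    by (simp add: G(2) p(2)[symmetric] subspace_scale)
  then show ?thesis
    using that[of G] G p(2) complex_poly_homogeneous[OF G(1) S]
    unfolding complexifies_def by auto
qed

text \<open>Real-rootedness along \<open>e\<close> is expressed by a factorization, with the roots being \<open>- r i\<close>, so that
  multiplicities are available without further work.\<close>
definition hyperbolic_on :: "'a set \<Rightarrow> nat \<Rightarrow> ('a::real_normed_vector \<Rightarrow> real) \<Rightarrow> 'a \<Rightarrow> bool" where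
  "hyperbolic_on S N g e \<longleftrightarrow> e \<in> S \<and> g e > 0 \<and>
     (\<forall>X\<in>S. \<exists>r. \<forall>t. g (X + t *\<^sub>R e) = g e * (\<Prod>i<N. t + r i))"

text \<open>The description of the Garding cone by the absence of nonnegative roots is the convenient one in
  computations; \<open>connected_component_eq_hyperbolicity_cone\<close> identifies it with a connected
  component of the set where \<open>g\<close> does not vanish.\<close>
definition hyperbolicity_cone :: "'a set \<Rightarrow> ('a::real_vector \<Rightarrow> real) \<Rightarrow> 'a \<Rightarrow> 'a set" where
  "hyperbolicity_cone S g e = {X \<in> S. \<forall>t\<ge>0. g (X + t *\<^sub>R e) > 0}"

text \<open>All hyperbolicity proofs go through complex roots: they rule out nonreal zeros of the
  complexification, and the complex factorization then has real roots.\<close>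
lemma hyperbolic_onI:
  assumes S: "subspace S" and G: "complexifies G S N g" and e: "e \<in> S" "g e > 0"
    and real: "\<And>X w. X \<in> S \<Longrightarrow> G ((X, 0) + cscale w (e, 0)) = 0 \<Longrightarrow> w \<in> \<real>"
  shows "hyperbolic_on S N g e"
  unfolding hyperbolic_on_def
proof (intro conjI ballI e)
  fix X assume X: "X \<in> S"
  have Ge: "G (e, 0) = of_real (g e)"
    using complexifies_real[OF G e(1)] .
  obtain r where r: "\<And>w. G ((X, 0) + cscale w (e, 0)) = G (e, 0) * (\<Prod>i<N. w - r i)"
    using complex_poly_factorization[OF complexifies_poly[OF G] S complexifies_homogeneous[OF G],
        of "(X, 0)" "(e, 0)"] subspace_0[OF S] X e Ge by auto
  have r_real: "r i = of_real (Re (r i))" if "i < N" for i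
  proof -
    have "r i \<in> \<real>"
      by (rule real[OF X]) (use that in \<open>auto simp: r\<close>)
    then show ?thesis by simp
  qed
  have "g (X + t *\<^sub>R e) = g e * (\<Prod>i<N. t + (- Re (r i)))" for t
  proof -
    have "complex_of_real (g (X + t *\<^sub>R e)) = G ((X, 0) + cscale (of_real t) (e, 0))"
      using complexifies_real[OF G, of "X + t *\<^sub>R e"] X e(1) S
      by (simp add: cscale_def subspace_add subspace_scale)
    also have "\<dots> = of_real (g e) * (\<Prod>i<N. of_real t - r i)"
      by (simp only: r Ge)
    also have "(\<Prod>i<N. of_real t - r i) = (\<Prod>i<N. of_real (t + (- Re (r i))))"
      by (intro prod.cong refl) (use r_real in force)
    finally show ?thesis
      by (simp only: of_real_eq_iff flip: of_real_prod of_real_mult)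
  qed
  then show "\<exists>r. \<forall>t. g (X + t *\<^sub>R e) = g e * (\<Prod>i<N. t + r i)"
    by (intro exI allI)
qed

text \<open>Both sides are polynomials in \<open>w\<close> that agree for real \<open>w\<close>.\<close>
lemma complexified_factorization:
  assumes S: "subspace S" and G: "complexifies G S N g" and e: "e \<in> S" and X: "X \<in> S"
    and r: "\<And>t. g (X + t *\<^sub>R e) = g e * (\<Prod>i<N. t + r i)"
  shows "G ((X, 0) + cscale w (e, 0)) = of_real (g e) * (\<Prod>i<N. w + of_real (r i))"
proof -
  obtain q where q: "\<And>w. G ((X, 0) + cscale w (e, 0)) = poly q w"
    using complexifies_poly[OF G] unfolding complex_poly_def by meson
  have "q = smult (of_real (g e)) (\<Prod>i<N. [:of_real (r i), 1:])"
  proof (rule poly_eq_if_eq_on_reals)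
    fix t :: real
    have "poly q (of_real t) = of_real (g (X + t *\<^sub>R e))"
      using complexifies_real[OF G, of "X + t *\<^sub>R e"] X e S
      by (simp add: q[symmetric] cscale_def subspace_add subspace_scale)
    then show "poly q (of_real t) = poly (smult (of_real (g e)) (\<Prod>i<N. [:of_real (r i), 1:])) (of_real t)"
      by (simp add: r poly_prod add.commute)
  qed
  then show ?thesis
    by (simp add: q poly_prod add.commute)
qed

lemma hyperbolicity_cone_roots_pos:
  fixes r :: "nat \<Rightarrow> real"
  assumes "X \<in> hyperbolicity_cone S g e" and r: "\<And>t. g (X + t *\<^sub>R e) = g e * (\<Prod>i<N. t + r i)"
    and "i < N"
  shows "r i > 0"
proof (rule ccontr)
  assume "\<not> r i > 0"
  then have "g (X + (- r i) *\<^sub>R e) > 0"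
    using assms(1) unfolding hyperbolicity_cone_def by (auto dest: spec[of _ "- r i"])
  moreover have "(\<Prod>j<N. - r i + r j) = 0"
    using assms(3) by auto
  ultimately show False
    by (simp only: r)
qed

text \<open>Garding's theorem. To see that \<open>w \<mapsto> g(X + w B)\<close> has no root in the upper half plane, one
  deforms \<open>i e + w B\<close> into \<open>X + w B\<close> through \<open>s X + i (1 - s) e + w B\<close>. For \<open>s < 1\<close> a real root \<open>w\<close>
  would make \<open>i (1 - s)\<close> a root of \<open>z \<mapsto> g(s X + w B + z e)\<close>, which has only real roots. At the start
  \<open>s = 0\<close>, a root \<open>w\<close> satisfies \<open>i / w = - b\<^sub>i\<close> with \<open>b\<^sub>i > 0\<close>, so it lies in the lower half plane.
  The lower half plane is treated by replacing \<open>X\<close> with \<open>- X\<close>.\<close>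
theorem hyperbolic_on_cone:
  assumes S: "subspace S" and g: "homogeneous_poly_on S N g"
    and e: "hyperbolic_on S N g e" and B: "B \<in> hyperbolicity_cone S g e"
  shows "hyperbolic_on S N g B"
proof -
  obtain G where G: "complexifies G S N g"
    using homogeneous_poly_complexify[OF S g] .
  have hom: "G (cscale w Z) = w ^ N * G Z" if "Z \<in> S \<times> S" for w Z
    using complexifies_homogeneous[OF G that] .
  have eS: "e \<in> S" "g e > 0" and BS: "B \<in> S"
    using e B by (auto simp: hyperbolic_on_def hyperbolicity_cone_def)
  have zS: "0 \<in> S" using S by (rule subspace_0)
  have gB: "g B > 0"
    using B unfolding hyperbolicity_cone_def by (auto dest: spec[of _ 0])
  have GB: "G (B, 0) \<noteq> 0"
    using gB complexifies_real[OF G BS] by simp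
  obtain b where b: "\<And>t. g (B + t *\<^sub>R e) = g e * (\<Prod>i<N. t + b i)"
    using e BS unfolding hyperbolic_on_def by meson
  have b_pos: "b i > 0" if "i < N" for i
    using hyperbolicity_cone_roots_pos[OF B b that] .
  have no_upper: "G ((X, 0) + cscale w (B, 0)) \<noteq> 0" if X: "X \<in> S" and w: "Im w > 0" for X w
  proof -
    define Z where "Z = (\<lambda>s::real. (s *\<^sub>R X, (1 - s) *\<^sub>R e))"
    have "G (Z 1 + cscale w (B, 0)) \<noteq> 0"
    proof (rule no_roots_in_upper_half_plane[where S = S and N = N and Z = Z])
      show "complex_poly G" using G by (rule complexifies_poly)
      show "subspace S" by fact
      show "\<And>Z w. Z \<in> S \<times> S \<Longrightarrow> G (cscale w Z) = w ^ N * G Z" by (rule hom)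
      show "continuous_on {0..1} Z" unfolding Z_def by (intro continuous_intros)
      show "\<And>s. Z s \<in> S \<times> S" using X eS S by (simp add: Z_def subspace_scale)
      show "(B, 0) \<in> S \<times> S" using BS zS by simp
      show "G (B, 0) \<noteq> 0" by fact
      show "Im w > 0" by fact
    next
      fix s t :: real assume s: "0 \<le> s" "s < 1"
      have XB: "s *\<^sub>R X + t *\<^sub>R B \<in> S"
        using X BS S by (simp add: subspace_add subspace_scale)
      obtain r where r: "\<And>u. g ((s *\<^sub>R X + t *\<^sub>R B) + u *\<^sub>R e) = g e * (\<Prod>i<N. u + r i)"
        using e XB unfolding hyperbolic_on_def by meson
      have "Z s + cscale (of_real t) (B, 0) = (s *\<^sub>R X + t *\<^sub>R B, 0) + cscale (\<i> * of_real (1 - s)) (e, 0)"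
        by (simp add: Z_def cscale_def)
      also have "G \<dots> = of_real (g e) * (\<Prod>i<N. \<i> * of_real (1 - s) + of_real (r i))"
        by (rule complexified_factorization[OF S G eS(1) XB r])
      also have "\<dots> \<noteq> 0"
        using eS(2) s by (auto simp del: of_real_diff) (auto simp: complex_eq_iff)
      finally show "G (Z s + cscale (of_real t) (B, 0)) \<noteq> 0" .
    next
      fix w :: complex assume w: "Im w > 0"
      then have w0: "w \<noteq> 0" by auto
      have "Z 0 + cscale w (B, 0) = cscale w ((B, 0) + cscale (\<i> / w) (e, 0))"
        using w0 unfolding cscale_add cscale_cscale by (simp add: Z_def cscale_def)
      also have "G \<dots> = w ^ N * (of_real (g e) * (\<Prod>i<N. \<i> / w + of_real (b i)))"
      proof -
        have "(B, 0) + cscale (\<i> / w) (e, 0) \<in> S \<times> S"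
          using BS eS zS S by (intro add_mem_Times cscale_mem) auto
        then show ?thesis
          by (simp only: hom complexified_factorization[OF S G eS(1) BS b])
      qed
      also have "\<dots> \<noteq> 0"
      proof -
        have "\<i> / w + of_real (b i) \<noteq> 0" if "i < N" for i
        proof
          assume "\<i> / w + of_real (b i) = 0"
          then have "\<i> + of_real (b i) * w = 0"
            using w0 by (simp add: field_simps)
          then have "1 + b i * Im w = 0"
            by (simp add: complex_eq_iff)
          moreover have "b i * Im w > 0" using b_pos[OF that] w by simp
          ultimately show False by simp
        qed
        then show ?thesis using w0 eS(2) by simp
      qed
      finally show "G (Z 0 + cscale w (B, 0)) \<noteq> 0" .
    qed
    then show ?thesis by (simp add: Z_def)
  qed
  show ?thesis
  proof (rule hyperbolic_onI[OF S G BS gB])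
    fix X w assume X: "X \<in> S" and root: "G ((X, 0) + cscale w (B, 0)) = 0"
    have "(- X, 0) + cscale (- w) (B, 0) = cscale (- 1) ((X, 0) + cscale w (B, 0))"
      unfolding cscale_add cscale_cscale by (simp add: cscale_def)
    also have "G \<dots> = 0"
      using root X BS zS S by (simp add: hom add_mem_Times cscale_mem)
    finally have "\<not> Im (- w) > 0"
      using no_upper[of "- X" "- w"] X S by (auto simp: subspace_neg)
    moreover have "\<not> Im w > 0"
      using no_upper[OF X, of w] root by auto
    ultimately show "w \<in> \<real>"
      by (simp add: complex_is_Real_iff)
  qed
qed

section \<open>The hyperbolicity cone\<close>
lemma homogeneous_poly_scale:
  "homogeneous_poly_on S N g \<Longrightarrow> A \<in> S \<Longrightarrow> g (t *\<^sub>R A) = t ^ N * g A"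
  by (simp add: homogeneous_poly_on_def)

text \<open>By homogeneity the ray from \<open>X\<close> in the direction \<open>e\<close> can be replaced by the segment from \<open>X\<close> to
  \<open>e\<close>. Compactness of the segment makes openness of the cone accessible.\<close>
lemma hyperbolicity_cone_iff_segment:
  assumes S: "subspace S" and g: "homogeneous_poly_on S N g" and e: "hyperbolic_on S N g e"
    and X: "X \<in> S"
  shows "X \<in> hyperbolicity_cone S g e \<longleftrightarrow> (\<forall>u\<in>{0..1}. g ((1 - u) *\<^sub>R X + u *\<^sub>R e) > 0)"
proof -
  have eS: "e \<in> S" "g e > 0"
    using e by (auto simp: hyperbolic_on_def)
  have scale: "g ((1 - u) *\<^sub>R X + u *\<^sub>R e) = (1 - u) ^ N * g (X + (u / (1 - u)) *\<^sub>R e)" if "u < 1" for u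
  proof -
    have "(1 - u) *\<^sub>R X + u *\<^sub>R e = (1 - u) *\<^sub>R (X + (u / (1 - u)) *\<^sub>R e)"
      using that by (simp add: scaleR_add_right)
    then show ?thesis
      using X eS S by (simp only: homogeneous_poly_scale[OF g] subspace_add subspace_scale)
  qed
  show ?thesis
  proof
    assume cone: "X \<in> hyperbolicity_cone S g e"
    show "\<forall>u\<in>{0..1}. g ((1 - u) *\<^sub>R X + u *\<^sub>R e) > 0"
    proof
      fix u :: real assume u: "u \<in> {0..1}"
      show "g ((1 - u) *\<^sub>R X + u *\<^sub>R e) > 0"
      proof (cases "u = 1")
        case False
        then have "g (X + (u / (1 - u)) *\<^sub>R e) > 0"
          using cone u by (simp add: hyperbolicity_cone_def)
        then show ?thesis
          using False u by (simp add: scale)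
      qed (use eS in simp)
    qed
  next
    assume seg: "\<forall>u\<in>{0..1}. g ((1 - u) *\<^sub>R X + u *\<^sub>R e) > 0"
    have "g (X + t *\<^sub>R e) > 0" if t: "t \<ge> 0" for t
    proof -
      define u where "u = t / (1 + t)"
      have u: "u \<in> {0..1}" "u < 1" "u / (1 - u) = t"
        using t by (auto simp: u_def field_simps)
      have "(1 - u) ^ N * g (X + t *\<^sub>R e) > 0"
        using seg u scale[OF u(2)] by metis
      then show ?thesis
        using u(2) by (simp add: zero_less_mult_iff)
    qed
    then show "X \<in> hyperbolicity_cone S g e"
      using X by (simp add: hyperbolicity_cone_def)
  qed
qed

text \<open>This bound, in contrast to the defining strict inequality, survives limits of \<open>X\<close>, and it still
  forces \<open>g\<close> to be positive for \<open>t > 0\<close>.\<close>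
lemma hyperbolicity_cone_lower_bound:
  assumes e: "hyperbolic_on S N g e" and X: "X \<in> hyperbolicity_cone S g e" and t: "t \<ge> 0"
  shows "g e * t ^ N \<le> g (X + t *\<^sub>R e)"
proof -
  have "X \<in> S" using X by (simp add: hyperbolicity_cone_def)
  then obtain r where r: "\<And>t. g (X + t *\<^sub>R e) = g e * (\<Prod>i<N. t + r i)"
    using e unfolding hyperbolic_on_def by meson
  have "(\<Prod>i<N. t) \<le> (\<Prod>i<N. t + r i)"
    using hyperbolicity_cone_roots_pos[OF X r] t by (intro prod_mono) (simp add: less_imp_le)
  then show ?thesis
    using e by (simp add: r hyperbolic_on_def)
qed

lemma closed_lower_bound:
  assumes "real_polynomial_function p"
  shows "closed {X :: 'a::euclidean_space. \<forall>t\<ge>0. c * t ^ N \<le> p (X + t *\<^sub>R e)}"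
proof -
  have p: "continuous_on T p" for T
    using assms by (metis continuous_on_polymonial_function real_polynomial_function_eq)
  have "closed {X. c * t ^ N \<le> p (X + t *\<^sub>R e)}" for t
    by (intro closed_Collect_le continuous_on_const continuous_on_compose2[OF p]
        continuous_on_add continuous_on_id) auto
  then have "closed (\<Inter>t\<in>{0..}. {X. c * t ^ N \<le> p (X + t *\<^sub>R e)})"
    by blast
  moreover have "(\<Inter>t\<in>{0..}. {X. c * t ^ N \<le> p (X + t *\<^sub>R e)})
      = {X. \<forall>t\<ge>0. c * t ^ N \<le> p (X + t *\<^sub>R e)}" by auto
  ultimately show ?thesis by simp
qed

text \<open>The cone is relatively closed in \<open>{g \<noteq> 0}\<close> by the lower bound above and open by compactness of
  segments, so it contains the component of \<open>e\<close>; it is star-shaped about \<open>e\<close>, so it is contained in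
  that component.\<close>
theorem connected_component_eq_hyperbolicity_cone:
  fixes g :: "'a::euclidean_space \<Rightarrow> real"
  assumes S: "subspace S" and g: "homogeneous_poly_on S N g" and e: "hyperbolic_on S N g e"
  shows "connected_component_set {A \<in> S. g A \<noteq> 0} e = hyperbolicity_cone S g e"
proof
  define C where "C = connected_component_set {A \<in> S. g A \<noteq> 0} e"
  let ?K = "hyperbolicity_cone S g e"
  have eS: "e \<in> S" "g e > 0"
    using e by (auto simp: hyperbolic_on_def)
  obtain p where p: "real_polynomial_function p" and gp: "\<And>X. X \<in> S \<Longrightarrow> g X = p X"
    using g unfolding homogeneous_poly_on_def by blast
  have pc: "continuous_on T p" for T
    using p by (metis continuous_on_polymonial_function real_polynomial_function_eq)
  have CS: "C \<subseteq> {A \<in> S. g A \<noteq> 0}"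
    unfolding C_def by (rule connected_component_subset)
  have eC: "e \<in> C" using eS by (simp add: C_def)
  have shift: "X + t *\<^sub>R e \<in> S" if "X \<in> S" for X t
    using that eS S by (simp add: subspace_add subspace_scale)
  have seg: "(1 - u) *\<^sub>R X + u *\<^sub>R e \<in> S" if "X \<in> S" for X u
    using that eS S by (simp add: subspace_add subspace_scale)
  have closed_part: "closedin (top_of_set C) (C \<inter> ?K)"
  proof -
    have "X \<in> ?K \<longleftrightarrow> (\<forall>t\<ge>0. g e * t ^ N \<le> p (X + t *\<^sub>R e))" if X: "X \<in> C" for X
    proof
      show "\<forall>t\<ge>0. g e * t ^ N \<le> p (X + t *\<^sub>R e)" if "X \<in> ?K"
        using hyperbolicity_cone_lower_bound[OF e that] gp shift X CS by auto
    next
      assume lower: "\<forall>t\<ge>0. g e * t ^ N \<le> p (X + t *\<^sub>R e)"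
      have XS: "X \<in> S" "g X \<noteq> 0" using X CS by auto
      have "g (X + t *\<^sub>R e) > 0" if t: "t \<ge> 0" for t
      proof (cases "t = 0")
        case True
        have "0 \<le> g e * 0 ^ N" using eS by simp
        also have "\<dots> \<le> g X"
          using lower[rule_format, of 0] gp XS by simp
        finally show ?thesis using XS(2) True by simp
      next
        case False
        then have "0 < g e * t ^ N" using t eS by simp
        then show ?thesis
          using lower[rule_format, OF t] gp[OF shift[OF XS(1)]] by simp
      qed
      then show "X \<in> ?K" using XS by (simp add: hyperbolicity_cone_def)
    qed
    then have "C \<inter> ?K = C \<inter> {X. \<forall>t\<ge>0. g e * t ^ N \<le> p (X + t *\<^sub>R e)}"
      by auto
    then show ?thesis
      using closedin_closed_Int[OF closed_lower_bound[OF p], of C] by simp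
  qed
  have open_part: "openin (top_of_set C) (C \<inter> ?K)"
  proof -
    define U where "U = - {X. \<exists>u. u \<in> {0..1} \<and> (u, X) \<in> {x. p ((1 - fst x) *\<^sub>R snd x + fst x *\<^sub>R e) \<le> 0}}"
    have "closed {x :: real \<times> 'a. p ((1 - fst x) *\<^sub>R snd x + fst x *\<^sub>R e) \<le> 0}"
      by (intro closed_Collect_le continuous_on_const continuous_on_compose2[OF pc] continuous_intros) auto
    then have "open U"
      unfolding U_def by (intro open_Compl closed_compact_projection compact_Icc)
    have "X \<in> ?K \<longleftrightarrow> X \<in> U" if "X \<in> C" for X
    proof -
      have XS: "X \<in> S" using that CS by auto
      show ?thesis
        unfolding hyperbolicity_cone_iff_segment[OF S g e XS] gp[OF seg[OF XS]]
        by (auto simp: U_def Ball_def not_le not_less) (meson not_less)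
    qed
    then have "C \<inter> ?K = C \<inter> U" by blast
    with \<open>open U\<close> show ?thesis
      using openin_open_Int[of U C] by simp
  qed
  have "connected C" unfolding C_def by simp
  moreover have "e \<in> ?K"
    using eS by (auto simp: hyperbolicity_cone_iff_segment[OF S g e] algebra_simps)
  ultimately have "C \<inter> ?K = C"
    using open_part closed_part eC unfolding connected_clopen by blast
  then show "connected_component_set {A \<in> S. g A \<noteq> 0} e \<subseteq> ?K"
    unfolding C_def by blast
  show "?K \<subseteq> connected_component_set {A \<in> S. g A \<noteq> 0} e"
  proof
    fix X assume X: "X \<in> ?K"
    then have XS: "X \<in> S" by (simp add: hyperbolicity_cone_def)
    have "closed_segment X e \<subseteq> {A \<in> S. g A \<noteq> 0}"
      using X seg[OF XS] unfolding hyperbolicity_cone_iff_segment[OF S g e XS]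
      by (force simp: closed_segment_def)
    then have "closed_segment X e \<subseteq> connected_component_set {A \<in> S. g A \<noteq> 0} e"
      by (intro connected_component_maximal) auto
    then show "X \<in> connected_component_set {A \<in> S. g A \<noteq> 0} e"
      by auto
  qed
qed

text \<open>Each of the two cones is the component of its direction, and \<open>B\<close> and \<open>e\<close> lie in the same
  component.\<close>
lemma hyperbolicity_cone_eq:
  fixes g :: "'a::euclidean_space \<Rightarrow> real"
  assumes S: "subspace S" and g: "homogeneous_poly_on S N g" and e: "hyperbolic_on S N g e"
    and B: "B \<in> hyperbolicity_cone S g e"
  shows "hyperbolicity_cone S g B = hyperbolicity_cone S g e"
proof -
  have "B \<in> connected_component_set {A \<in> S. g A \<noteq> 0} e"
    using B by (simp add: connected_component_eq_hyperbolicity_cone[OF S g e])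
  from connected_component_eq[OF this] show ?thesis
    by (simp add: connected_component_eq_hyperbolicity_cone[OF S g e]
        connected_component_eq_hyperbolicity_cone[OF S g hyperbolic_on_cone[OF S g e B]])
qed

text \<open>The lower bound extends to the closure and is strictly positive once \<open>s > 0\<close>.\<close>
lemma closure_hyperbolicity_cone_shift:
  fixes g :: "'a::euclidean_space \<Rightarrow> real"
  assumes S: "subspace S" and g: "homogeneous_poly_on S N g" and e: "hyperbolic_on S N g e"
    and X: "X \<in> S" "X \<in> closure (hyperbolicity_cone S g e)" and s: "s > 0"
  shows "X + s *\<^sub>R e \<in> hyperbolicity_cone S g e"
proof -
  have eS: "e \<in> S" "g e > 0"
    using e by (auto simp: hyperbolic_on_def)
  obtain p where p: "real_polynomial_function p" and gp: "\<And>X. X \<in> S \<Longrightarrow> g X = p X"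
    using g unfolding homogeneous_poly_on_def by blast
  have shift: "X + t *\<^sub>R e \<in> S" if "X \<in> S" for X t
    using that eS S by (simp add: subspace_add subspace_scale)
  have "hyperbolicity_cone S g e \<subseteq> {X. \<forall>t\<ge>0. g e * t ^ N \<le> p (X + t *\<^sub>R e)}"
    using hyperbolicity_cone_lower_bound[OF e] gp shift by (fastforce simp: hyperbolicity_cone_def)
  then have "closure (hyperbolicity_cone S g e) \<subseteq> {X. \<forall>t\<ge>0. g e * t ^ N \<le> p (X + t *\<^sub>R e)}"
    by (intro closure_minimal closed_lower_bound[OF p])
  then have lower: "g e * t ^ N \<le> g (X + t *\<^sub>R e)" if "t \<ge> 0" for t
    using X gp shift that by auto
  have "g (X + s *\<^sub>R e + t *\<^sub>R e) > 0" if "t \<ge> 0" for t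
  proof -
    have "0 < g e * (s + t) ^ N" using eS s that by simp
    also have "\<dots> \<le> g (X + (s + t) *\<^sub>R e)" using lower s that by simp
    finally show ?thesis by (simp add: scaleR_add_left add.assoc)
  qed
  then show ?thesis
    using shift[OF X(1)] by (simp add: hyperbolicity_cone_def)
qed

section \<open>The tangent inequality\<close>

text \<open>Along the line \<open>t \<mapsto> B + t A\<close> the polynomial equals \<open>g(B)\<close> times the product of the
  \<open>1 + t r\<^sub>i\<close>, where the \<open>r\<^sub>i\<close> are positive and their product is \<open>g(A) / g(B)\<close>. The derivative of its
  \<open>N\<close>-th root at \<open>t = 0\<close> is \<open>g(B)\<^sup>1\<^sup>/\<^sup>N\<close> times the arithmetic mean of the \<open>r\<^sub>i\<close>, which is at least
  \<open>g(B)\<^sup>1\<^sup>/\<^sup>N\<close> times their geometric mean.\<close>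
theorem hyperbolic_root_le_derivative:
  fixes g :: "'a::real_normed_vector \<Rightarrow> real"
  assumes N: "N \<ge> 1" and S: "subspace S" and g: "homogeneous_poly_on S N g"
    and B: "hyperbolic_on S N g B" and A: "A \<in> hyperbolicity_cone S g B"
    and d: "((\<lambda>t. root N (g (B + t *\<^sub>R A))) has_real_derivative d) (at 0)"
  shows "root N (g A) \<le> d"
proof -
  have BS: "B \<in> S" "g B > 0" and AS: "A \<in> S"
    using B A by (auto simp: hyperbolic_on_def hyperbolicity_cone_def)
  obtain r where r: "\<And>t. g (A + t *\<^sub>R B) = g B * (\<Prod>i<N. t + r i)"
    using B AS unfolding hyperbolic_on_def by meson
  have r_pos: "r i > 0" if "i < N" for i
    using hyperbolicity_cone_roots_pos[OF A r that] .
  have line: "g (B + t *\<^sub>R A) = g B * (\<Prod>i<N. 1 + t * r i)" for t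
  proof (cases "t = 0")
    case False
    then have "B + t *\<^sub>R A = t *\<^sub>R (A + inverse t *\<^sub>R B)"
      by (simp add: scaleR_add_right)
    then have "g (B + t *\<^sub>R A) = t ^ N * g (A + inverse t *\<^sub>R B)"
      using AS BS S by (simp only: homogeneous_poly_scale[OF g] subspace_add subspace_scale)
    also have "\<dots> = g B * ((\<Prod>i<N. t) * (\<Prod>i<N. inverse t + r i))"
      by (simp add: r)
    also have "(\<Prod>i<N. t) * (\<Prod>i<N. inverse t + r i) = (\<Prod>i<N. 1 + t * r i)"
      using False by (simp only: flip: prod.distrib) (simp add: algebra_simps)
    finally show ?thesis .
  qed simp
  define b where "b = root N (g B)"
  have b: "b > 0" "b ^ N = g B"
    using BS N by (simp_all add: b_def)
  have "((\<lambda>t. g B * (\<Prod>i<N. 1 + t * r i)) has_real_derivative g B * (\<Sum>i<N. r i)) (at 0)"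
    by (auto intro!: derivative_eq_intros has_field_derivative_prod)
  then have "((\<lambda>t. root N (g (B + t *\<^sub>R A))) has_real_derivative
      inverse (real N * b ^ (N - Suc 0)) * (g B * (\<Sum>i<N. r i))) (at 0)"
    unfolding line b_def
    using DERIV_chain2[of "root N" _ "\<lambda>t. g B * (\<Prod>i<N. 1 + t * r i)" 0]
      DERIV_real_root[of N "g B"] N BS by simp
  then have "d = inverse (real N * b ^ (N - Suc 0)) * (g B * (\<Sum>i<N. r i))"
    using d DERIV_unique by blast
  also have "g B = b * b ^ (N - Suc 0)"
    using N b(2) by (cases N) auto
  finally have d_eq: "d = b * (\<Sum>i<N. r i / N)"
    using b(1) N by (simp add: field_simps flip: sum_divide_distrib)
  have "root N (g A) = b * root N (\<Prod>i<N. r i)"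
    using r[of 0] N by (simp add: b_def real_root_mult)
  also have "root N (\<Prod>i<N. r i) = (\<Prod>i<N. r i) powr (1 / N)"
    using N r_pos by (subst root_powr_inverse) (auto intro!: prod_nonneg simp: less_imp_le)
  also have "b * \<dots> \<le> b * (\<Sum>i<N. r i / N)"
    using arith_geom_mean[of "{..<N}" r] N r_pos b(1)
    by (intro mult_left_mono) (auto simp: less_imp_le lessThan_empty_iff)
  finally show ?thesis using d_eq by simp
qed

section \<open>Garding-Dirichlet polynomials on symmetric matrices\<close>
lemma subspace_sym_mats: "subspace (sym_mats :: (real ^ 'n ^ 'n) set)"
  by (auto simp: subspace_def sym_mats_def transpose_def vec_eq_iff)

lemma mat_1_sym_mats: "mat 1 \<in> sym_mats"
  by (simp add: sym_mats_def)

lemma homogeneous_poly_on_sym_iff: "homogeneous_poly_on_sym N g \<longleftrightarrow> homogeneous_poly_on sym_mats N g"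
  by (simp add: homogeneous_poly_on_sym_def homogeneous_poly_on_def)

lemma poly_map_poly_of_real:
  "poly (map_poly of_real p) (of_real t) = (of_real (poly p t) :: complex)"
  by (induction p) (simp_all add: map_poly_pCons)

lemma garding_dirichlet_hyperbolic:
  fixes g :: "real ^ 'n ^ 'n \<Rightarrow> real"
  assumes g: "garding_dirichlet N g"
  shows "hyperbolic_on sym_mats N g (mat 1)"
proof -
  have hg: "homogeneous_poly_on sym_mats N g" and g1: "g (mat 1) > 0"
    using g by (auto simp: garding_dirichlet_def homogeneous_poly_on_sym_iff)
  obtain G where G: "complexifies G sym_mats N g"
    using homogeneous_poly_complexify[OF subspace_sym_mats hg] .
  show ?thesis
  proof (rule hyperbolic_onI[OF subspace_sym_mats G mat_1_sym_mats g1])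
    fix X w assume X: "X \<in> sym_mats" and root: "G ((X, 0) + cscale w (mat 1, 0)) = 0"
    obtain q where q: "\<And>t. poly q t = g (t *\<^sub>R mat 1 + X)" "all_roots_real q"
      using g X unfolding garding_dirichlet_def by blast
    obtain p where p: "\<And>w. G ((X, 0) + cscale w (mat 1, 0)) = poly p w"
      using complexifies_poly[OF G] unfolding complex_poly_def by meson
    have "p = map_poly of_real q"
    proof (rule poly_eq_if_eq_on_reals)
      fix t :: real
      have "poly p (of_real t) = of_real (g (X + t *\<^sub>R mat 1))"
        using complexifies_real[OF G, of "X + t *\<^sub>R mat 1"] X
        by (simp add: p[symmetric] cscale_def subspace_add subspace_scale subspace_sym_mats mat_1_sym_mats)
      then show "poly p (of_real t) = poly (map_poly of_real q) (of_real t)"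
        by (simp add: q(1) add.commute poly_map_poly_of_real)
    qed
    then show "w \<in> \<real>"
      using q(2) root unfolding all_roots_real_def p by simp
  qed
qed

text \<open>The minimum of the quadratic form on the unit sphere serves as \<open>\<epsilon>\<close>.\<close>
lemma pos_def_minus_scalar:
  fixes A :: "real ^ 'n ^ 'n"
  assumes A: "pos_def A"
  obtains \<epsilon> where "\<epsilon> > 0" "pos_semidef (A - \<epsilon> *\<^sub>R mat 1)"
proof -
  let ?q = "\<lambda>x. x \<bullet> (A *v x)"
  have cont: "continuous_on (sphere 0 1) ?q"
    by (intro continuous_on_inner continuous_on_id linear_continuous_on linear_conv_bounded_linear[THEN iffD1]
        matrix_vector_mul_linear)
  have "axis undefined 1 \<in> sphere (0 :: real ^ 'n) 1" by (simp add: norm_eq_1 inner_axis_axis)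
  then have "sphere (0 :: real ^ 'n) 1 \<noteq> {}" by blast
  then obtain u where u: "u \<in> sphere (0 :: real ^ 'n) 1" "\<And>x. x \<in> sphere 0 1 \<Longrightarrow> ?q u \<le> ?q x"
    using continuous_attains_inf[OF compact_sphere _ cont] by blast
  have "u \<noteq> 0" using u(1) by auto
  then have "?q u > 0"
    using A by (simp add: pos_def_def)
  moreover have "pos_semidef (A - ?q u *\<^sub>R mat 1)"
    unfolding pos_semidef_def
  proof (intro conjI allI)
    show "A - ?q u *\<^sub>R mat 1 \<in> sym_mats"
      using A by (simp add: pos_def_def subspace_diff subspace_scale subspace_sym_mats mat_1_sym_mats)
    fix x :: "real ^ 'n"
    have "?q u * (norm x)\<^sup>2 \<le> ?q x"
    proof (cases "x = 0")
      case False
      then have "?q u \<le> ?q ((1 / norm x) *\<^sub>R x)"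
        by (intro u(2)) simp
      also have "\<dots> = ?q x / (norm x)\<^sup>2"
        by (simp add: matrix_vector_mult_scaleR power2_eq_square)
      finally show ?thesis
        using False by (simp add: field_simps)
    qed simp
    then show "0 \<le> x \<bullet> ((A - ?q u *\<^sub>R mat 1) *v x)"
      by (simp add: matrix_vector_mult_diff_rdistrib scaleR_matrix_vector_assoc[symmetric] inner_diff_right power2_norm_eq_inner)
  qed
  ultimately show ?thesis by (rule that)
qed

lemma garding_cone_eq_hyperbolicity_cone:
  assumes "garding_dirichlet N g"
  shows "garding_cone g = hyperbolicity_cone sym_mats g (mat 1)"
  unfolding garding_cone_def
  using assms connected_component_eq_hyperbolicity_cone[OF subspace_sym_mats _ garding_dirichlet_hyperbolic[OF assms]]
  by (simp add: garding_dirichlet_def homogeneous_poly_on_sym_iff)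

text \<open>The Dirichlet condition places only the closure of the cone around the semidefinite matrices.
  Writing \<open>A = (A - \<epsilon> I) + \<epsilon> I\<close> with a semidefinite first summand moves \<open>A\<close> into the cone itself.\<close>
lemma pos_def_in_garding_cone:
  assumes g: "garding_dirichlet N g" and A: "pos_def A"
  shows "A \<in> garding_cone g"
proof -
  obtain \<epsilon> where \<epsilon>: "\<epsilon> > 0" "pos_semidef (A - \<epsilon> *\<^sub>R mat 1)"
    using pos_def_minus_scalar[OF A] .
  have "A - \<epsilon> *\<^sub>R mat 1 \<in> closure (hyperbolicity_cone sym_mats g (mat 1))"
    using g \<epsilon>(2) unfolding garding_dirichlet_def garding_cone_eq_hyperbolicity_cone[OF g, symmetric] by blast
  then have "A - \<epsilon> *\<^sub>R mat 1 + \<epsilon> *\<^sub>R mat 1 \<in> hyperbolicity_cone sym_mats g (mat 1)"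
    using g \<epsilon> by (intro closure_hyperbolicity_cone_shift[OF subspace_sym_mats _ garding_dirichlet_hyperbolic[OF g]])
      (auto simp: garding_dirichlet_def homogeneous_poly_on_sym_iff pos_semidef_def)
  then show ?thesis
    by (simp add: garding_cone_eq_hyperbolicity_cone[OF g])
qed

section \<open>The determinant as a hyperbolic polynomial\<close>
lemma det_scaleR:
  fixes A :: "real ^ 'n ^ 'n"
  shows "det (t *\<^sub>R A) = t ^ CARD('n) * det A"
  by (simp add: det_def prod.distrib sum_distrib_left mult_ac)

lemma det_homogeneous_poly: "homogeneous_poly_on S CARD('n) (det :: real ^ 'n ^ 'n \<Rightarrow> real)"
proof -
  have "bounded_linear (\<lambda>A :: real ^ 'n ^ 'n. A $ i $ j)" for i j
    by (intro bounded_linear_compose[OF bounded_linear_vec_nth bounded_linear_vec_nth])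
  then have "real_polynomial_function (det :: real ^ 'n ^ 'n \<Rightarrow> real)"
    unfolding det_def[abs_def]
    by (intro real_polynomial_function_sum real_polynomial_function.intros real_polynomial_function_prod) (auto simp: finite_permutations)
  then show ?thesis
    by (auto simp: homogeneous_poly_on_def det_scaleR)
qed

text \<open>If \<open>det(X + w I) = 0\<close> there is a complex vector \<open>v \<noteq> 0\<close> with \<open>X v = - w v\<close>. Since \<open>X\<close> is real
  symmetric, the Hermitian form \<open>v\<^sup>* X v\<close> is real, and it equals \<open>- w\<close> times the squared norm of \<open>v\<close>.\<close>
lemma det_hyperbolic: "hyperbolic_on sym_mats CARD('n) (det :: real ^ 'n ^ 'n \<Rightarrow> real) (mat 1)"
proof -
  obtain G where G: "complexifies G (sym_mats :: (real ^ 'n ^ 'n) set) CARD('n) det"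
    using homogeneous_poly_complexify[OF subspace_sym_mats det_homogeneous_poly] .
  show ?thesis
  proof (rule hyperbolic_onI[OF subspace_sym_mats G mat_1_sym_mats])
    fix X :: "real ^ 'n ^ 'n" and w
    assume X: "X \<in> sym_mats" and root: "G ((X, 0) + cscale w (mat 1, 0)) = 0"
    define M where "M = (\<lambda>w. (\<chi> i j. of_real (X $ i $ j) + w * (if i = j then 1 else 0)) :: complex ^ 'n ^ 'n)"
    obtain p where p: "\<And>w. G ((X, 0) + cscale w (mat 1, 0)) = poly p w"
      using complexifies_poly[OF G] unfolding complex_poly_def by meson
    define q where "q = (\<Sum>\<pi> | \<pi> permutes (UNIV :: 'n set). smult (of_int (sign \<pi>))
        (\<Prod>i\<in>UNIV. [:of_real (X $ i $ \<pi> i), if i = \<pi> i then 1 else 0:]) :: complex poly)"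
    have q: "poly q z = det (M z)" for z
      by (simp add: q_def det_def M_def poly_sum poly_prod)
    have "p = q"
    proof (rule poly_eq_if_eq_on_reals)
      fix t :: real
      have "poly p (of_real t) = of_real (det (X + t *\<^sub>R mat 1))"
        using complexifies_real[OF G, of "X + t *\<^sub>R mat 1"] X
        by (simp add: p[symmetric] cscale_def subspace_add subspace_scale subspace_sym_mats mat_1_sym_mats)
      also have "\<dots> = det (M (of_real t))"
        unfolding det_def of_real_sum of_real_mult of_real_prod of_real_of_int_eq M_def
        by (intro sum.cong prod.cong refl arg_cong2[of _ _ _ _ "(*)"]) (simp add: mat_def)
      finally show "poly p (of_real t) = poly q (of_real t)"
        by (simp add: q)
    qed
    then have "\<not> invertible (M w)"
      using root by (simp add: invertible_det_nz p q)
    then obtain v where v: "M w *v v = 0" "v \<noteq> 0"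
      using matrix_left_invertible_ker[of "M w"] invertible_left_inverse[of "M w"] by blast
    define s where "s = (\<Sum>i\<in>UNIV. \<Sum>j\<in>UNIV. of_real (X $ i $ j) * (cnj (v $ i) * v $ j))"
    define m where "m = (\<Sum>i\<in>UNIV. (cmod (v $ i))\<^sup>2)"
    have "(\<Sum>j\<in>UNIV. of_real (X $ i $ j) * v $ j) + w * v $ i = 0" for i
    proof -
      have "(M w *v v) $ i = (\<Sum>j\<in>UNIV. of_real (X $ i $ j) * v $ j + (if i = j then w * v $ j else 0))"
        unfolding matrix_vector_mult_def M_def by (auto intro!: sum.cong simp: algebra_simps)
      also have "\<dots> = (\<Sum>j\<in>UNIV. of_real (X $ i $ j) * v $ j) + w * v $ i"
        by (simp add: sum.distrib)
      finally show ?thesis using v(1) by simp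
    qed
    then have "(\<Sum>i\<in>UNIV. cnj (v $ i) * ((\<Sum>j\<in>UNIV. of_real (X $ i $ j) * v $ j) + w * v $ i)) = 0"
      by simp
    moreover have "(\<Sum>i\<in>UNIV. cnj (v $ i) * ((\<Sum>j\<in>UNIV. of_real (X $ i $ j) * v $ j) + w * v $ i))
        = s + w * of_real m"
      unfolding s_def m_def
      by (simp add: sum.distrib sum_distrib_left complex_norm_square algebra_simps flip: of_real_power)
    ultimately have eq: "s + w * of_real m = 0" by simp
    have sym: "X $ j $ i = X $ i $ j" for i j
      using X by (metis (mono_tags, lifting) mem_Collect_eq sym_mats_def transpose_def vec_lambda_beta)
    have "cnj s = (\<Sum>i\<in>UNIV. \<Sum>j\<in>UNIV. of_real (X $ j $ i) * (cnj (v $ j) * v $ i))"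
      by (simp add: s_def sym mult_ac)
    also have "\<dots> = s"
      unfolding s_def by (rule sum.swap)
    finally have "Im s = 0"
      by (simp add: complex_eq_iff)
    moreover have "m \<noteq> 0"
      using v(2) by (simp add: m_def sum_nonneg_eq_0_iff vec_eq_iff)
    moreover have "Im s + Im w * m = 0"
      using arg_cong[OF eq, of Im] by simp
    ultimately show "w \<in> \<real>"
      by (simp add: complex_is_Real_iff)
  qed simp
qed

text \<open>The numbers \<open>r i\<close> in the factorization of \<open>det(A + t I)\<close> are eigenvalues of \<open>A\<close>, hence
  positive.\<close>
lemma pos_def_in_det_cone:
  fixes A :: "real ^ 'n ^ 'n"
  assumes A: "pos_def A"
  shows "A \<in> hyperbolicity_cone sym_mats det (mat 1)"
proof -
  have AS: "A \<in> sym_mats" using A by (simp add: pos_def_def)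
  obtain r where r: "\<And>t. det (A + t *\<^sub>R mat 1) = (\<Prod>i<CARD('n). t + r i)"
    using det_hyperbolic AS unfolding hyperbolic_on_def by fastforce
  have "r i > 0" if i: "i < CARD('n)" for i
  proof -
    have "det (A + (- r i) *\<^sub>R mat 1) = 0"
      unfolding r using i by auto
    then have "\<not> invertible (A + (- r i) *\<^sub>R mat 1)"
      by (simp add: invertible_det_nz)
    then obtain v where v: "(A + (- r i) *\<^sub>R mat 1) *v v = 0" "v \<noteq> 0"
      using matrix_left_invertible_ker invertible_left_inverse by blast
    have "A *v v = r i *\<^sub>R v"
      using v(1) unfolding matrix_vector_mult_add_rdistrib scaleR_matrix_vector_assoc[symmetric] by simp
    then have "0 < r i * (v \<bullet> v)"
      using A v(2) unfolding pos_def_def by (metis inner_scaleR_right)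
    then show ?thesis
      using v(2) inner_ge_zero[of v] by (auto simp: zero_less_mult_iff)
  qed
  then have "det (A + t *\<^sub>R mat 1) > 0" if "t \<ge> 0" for t
    unfolding r using that by (intro prod_pos) (simp add: add_nonneg_pos)
  then show ?thesis
    using AS by (simp add: hyperbolicity_cone_def)
qed

lemma det_pos_def:
  fixes A :: "real ^ 'n ^ 'n"
  shows "pos_def A \<Longrightarrow> det A > 0"
  using pos_def_in_det_cone[of A] by (auto simp: hyperbolicity_cone_def dest: spec[of _ 0])

section \<open>Trace and determinant of positive definite matrices\<close>
lemma matrix_mult_add_left: "(A + B) ** C = A ** C + B ** (C :: real ^ 'n ^ 'm)"
  by (simp add: vec_eq_iff matrix_matrix_mult_def sum.distrib algebra_simps)

text \<open>In the Leibniz expansion only the identity permutation contributes to first order: any other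
  permutation moves at least two indices, and so still has an off-diagonal entry of the identity matrix
  as a factor after one factor has been differentiated.\<close>
lemma det_derivative_at_identity:
  fixes X :: "real ^ 'n ^ 'n"
  shows "((\<lambda>t. det (mat 1 + t *\<^sub>R X)) has_real_derivative trace X) (at 0)"
proof -
  let ?P = "{\<pi>. \<pi> permutes (UNIV :: 'n set)}"
  let ?T = "\<lambda>\<pi>. \<Sum>i\<in>UNIV. X $ i $ \<pi> i * (\<Prod>j\<in>UNIV - {i}. (mat 1 + 0 *\<^sub>R X :: real ^ 'n ^ 'n) $ j $ \<pi> j)"
  have "((\<lambda>t. \<Sum>\<pi>\<in>?P. of_int (sign \<pi>) * (\<Prod>i\<in>UNIV. (mat 1 + t *\<^sub>R X) $ i $ \<pi> i))
      has_real_derivative (\<Sum>\<pi>\<in>?P. of_int (sign \<pi>) * ?T \<pi>)) (at 0)"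
    by (intro DERIV_sum DERIV_cmult has_field_derivative_prod) (auto intro!: derivative_eq_intros)
  moreover have "(\<Sum>\<pi>\<in>?P. of_int (sign \<pi>) * ?T \<pi>) = (\<Sum>\<pi>\<in>?P. if \<pi> = id then trace X else 0)"
  proof (rule sum.cong[OF refl])
    fix \<pi> assume "\<pi> \<in> ?P"
    then have \<pi>: "\<pi> permutes UNIV" by simp
    show "of_int (sign \<pi>) * ?T \<pi> = (if \<pi> = id then trace X else 0)"
    proof (cases "\<pi> = id")
      case True
      then show ?thesis by (simp add: trace_def mat_def)
    next
      case False
      have "(\<Prod>j\<in>UNIV - {i}. (mat 1 + 0 *\<^sub>R X :: real ^ 'n ^ 'n) $ j $ \<pi> j) = 0" for i
      proof -
        obtain k where k: "\<pi> k \<noteq> k" using False by (auto simp: fun_eq_iff)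
        \<comment> \<open>Besides \<open>k\<close>, also \<open>\<pi> k\<close> is moved, and at least one of the two differs from \<open>i\<close>.\<close>
        have "\<pi> (\<pi> k) \<noteq> \<pi> k"
          using k permutes_inj[OF \<pi>] by (metis injD)
        with k obtain j where "j \<noteq> i" "\<pi> j \<noteq> j" by metis
        then show ?thesis by (intro prod_zero) (auto simp: mat_def intro!: bexI[of _ j])
      qed
      then show ?thesis using False by (simp only: mult_zero_right sum.neutral_const) simp
    qed
  qed
  moreover have "(\<Sum>\<pi>\<in>?P. if \<pi> = id then trace X else 0) = trace X"
    by (simp add: finite_permutations permutes_id)
  ultimately show ?thesis
    by (simp add: det_def)
qed

lemma pos_def_inverse:
  fixes D :: "real ^ 'n ^ 'n"
  assumes D: "pos_def D"
  obtains B where "pos_def B" "B ** D = mat 1" "D ** B = mat 1"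
proof -
  have "det D \<noteq> 0" using det_pos_def[OF D] by simp
  then obtain B where B: "B ** D = mat 1" "D ** B = mat 1"
    by (meson invertible_def invertible_det_nz)
  have DT: "transpose D = D" using D by (simp add: pos_def_def sym_mats_def)
  have "transpose B ** D = mat 1"
    using arg_cong[OF B(2), of transpose] by (simp add: matrix_transpose_mul DT)
  then have "transpose B = B"
    by (metis B(2) matrix_mul_assoc matrix_mul_lid matrix_mul_rid)
  moreover have "x \<bullet> (B *v x) > 0" if "x \<noteq> 0" for x
  proof -
    define y where "y = B *v x"
    have x: "x = D *v y"
      by (simp add: y_def matrix_vector_mul_assoc B)
    then have "y \<noteq> 0" using that by auto
    then have "y \<bullet> (D *v y) > 0" using D by (simp add: pos_def_def)
    then show ?thesis
      by (simp only: x[symmetric] y_def[symmetric]) (simp add: inner_commute)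
  qed
  ultimately have "pos_def B" by (simp add: pos_def_def sym_mats_def)
  then show ?thesis using B that by blast
qed

text \<open>The tangent inequality for \<open>det\<close> at \<open>B = D\<^sup>-\<^sup>1\<close>: from \<open>det(B + t A) = det B det(I + t D A)\<close>, the
  derivative of \<open>(det)\<^sup>1\<^sup>/\<^sup>n\<close> at \<open>B\<close> in the direction \<open>A\<close> is \<open>(det B)\<^sup>1\<^sup>/\<^sup>n trace(D A) / n\<close>.\<close>
lemma trace_det_arith_geom_mean:
  fixes A D :: "real ^ 'n ^ 'n"
  assumes A: "pos_def A" and D: "pos_def D"
  shows "real CARD('n) * root CARD('n) (det D) * root CARD('n) (det A) \<le> trace (D ** A)"
proof -
  let ?n = "CARD('n)"
  have n: "?n \<ge> 1" by (simp add: Suc_leI)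
  obtain B where B: "pos_def B" "B ** D = mat 1" "D ** B = mat 1"
    using pos_def_inverse[OF D] .
  note det_cone = hyperbolicity_cone_eq[OF subspace_sym_mats det_homogeneous_poly det_hyperbolic
      pos_def_in_det_cone[OF B(1)]]
  have hB: "hyperbolic_on sym_mats ?n det B"
    using hyperbolic_on_cone[OF subspace_sym_mats det_homogeneous_poly det_hyperbolic
      pos_def_in_det_cone[OF B(1)]] .
  have AB: "A \<in> hyperbolicity_cone sym_mats det B"
    unfolding det_cone by (rule pos_def_in_det_cone[OF A])
  define b where "b = root ?n (det B)"
  have dB: "det B > 0" using det_pos_def[OF B(1)] .
  have b: "b > 0" "b ^ ?n = det B"
    using dB by (simp_all add: b_def)
  have split: "det (B + t *\<^sub>R A) = det B * det (mat 1 + t *\<^sub>R (D ** A))" for t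
  proof -
    have "B ** (mat 1 + t *\<^sub>R (D ** A)) = B + t *\<^sub>R (B ** D ** A)"
      by (simp add: matrix_add_ldistrib matrix_mul_assoc scalar_matrix_assoc[symmetric] matrix_scalar_ac)
    then show ?thesis by (simp add: B flip: det_mul)
  qed
  have "((\<lambda>t. det B * det (mat 1 + t *\<^sub>R (D ** A))) has_real_derivative det B * trace (D ** A)) (at 0)"
    by (intro DERIV_cmult det_derivative_at_identity)
  then have "((\<lambda>t. root ?n (det (B + t *\<^sub>R A))) has_real_derivative
      inverse (real ?n * b ^ (?n - Suc 0)) * (det B * trace (D ** A))) (at 0)"
    unfolding split b_def
    using DERIV_chain2[of "root ?n" _ "\<lambda>t. det B * det (mat 1 + t *\<^sub>R (D ** A))" 0]
      DERIV_real_root[of ?n "det B"] dB by simp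
  then have "root ?n (det A) \<le> inverse (real ?n * b ^ (?n - Suc 0)) * (det B * trace (D ** A))"
    by (rule hyperbolic_root_le_derivative[OF n subspace_sym_mats det_homogeneous_poly hB AB])
  also have "det B = b * b ^ (?n - Suc 0)"
    using b(2) n by (metis One_nat_def power_eq_if not_one_le_zero)
  finally have "real ?n * root ?n (det A) \<le> b * trace (D ** A)"
    using b(1) n by (simp add: field_simps)
  moreover have "root ?n (det D) * b = 1"
    using arg_cong[OF B(3), of det] by (simp add: b_def det_mul flip: real_root_mult)
  moreover have "root ?n (det D) > 0"
    using det_pos_def[OF D] by simp
  ultimately have "root ?n (det D) * (real ?n * root ?n (det A)) \<le> root ?n (det D) * b * trace (D ** A)"
    unfolding mult.assoc by (intro mult_left_mono) (simp_all add: mult_ac)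
  then show ?thesis
    unfolding \<open>root ?n (det D) * b = 1\<close> by (simp add: mult_ac)
qed

lemma trace_scaleR: "trace (c *\<^sub>R A) = c * trace (A :: real ^ 'n ^ 'n)"
  by (simp add: trace_def sum_distrib_left)

lemma trace_pos_def:
  fixes A :: "real ^ 'n ^ 'n"
  assumes "pos_def A"
  shows "trace A > 0"
proof -
  have "A $ i $ i > 0" for i
  proof -
    have "axis i 1 \<bullet> (A *v axis i 1) > 0"
      using assms by (simp add: pos_def_def axis_eq_0_iff)
    then show ?thesis
      by (simp add: matrix_vector_mult_basis column_def inner_axis')
  qed
  then show ?thesis unfolding trace_def by (intro sum_pos) auto
qed

lemma pos_semidef_add_scalar:
  assumes "pos_semidef A" "\<epsilon> > 0"
  shows "pos_def (A + \<epsilon> *\<^sub>R mat 1)"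
  using assms unfolding pos_def_def pos_semidef_def
  by (auto simp: subspace_add subspace_scale subspace_sym_mats mat_1_sym_mats
      matrix_vector_mult_add_rdistrib scaleR_matrix_vector_assoc[symmetric] inner_add_right intro!: add_nonneg_pos)

lemma pos_semidef_outer:
  fixes x :: "real ^ 'n"
  shows "pos_semidef (\<chi> i j. x $ i * x $ j)"
  unfolding pos_semidef_def
proof (intro conjI allI)
  show "(\<chi> i j. x $ i * x $ j) \<in> sym_mats"
    by (simp add: sym_mats_def transpose_def vec_eq_iff mult.commute)
  fix y :: "real ^ 'n"
  have "y \<bullet> ((\<chi> i j. x $ i * x $ j) *v y) = (x \<bullet> y)\<^sup>2"
    by (simp add: inner_vec_def matrix_vector_mult_def power2_eq_square sum_product sum_distrib_left mult_ac)
  then show "0 \<le> y \<bullet> ((\<chi> i j. x $ i * x $ j) *v y)" by simp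
qed

lemma trace_mult_outer:
  fixes D :: "real ^ 'n ^ 'n"
  shows "trace (D ** (\<chi> i j. x $ i * x $ j)) = x \<bullet> (D *v x)"
  by (simp add: trace_def matrix_matrix_mult_def inner_vec_def matrix_vector_mult_def sum_distrib_left mult_ac)

text \<open>If \<open>y = D x\<close> were nonzero, the form at \<open>x + t y\<close> would have the linear term \<open>2 t (y \<bullet> y)\<close> and no
  constant term, and would be negative for a suitable small \<open>t < 0\<close>.\<close>
lemma pos_semidef_null_vector:
  fixes D :: "real ^ 'n ^ 'n"
  assumes D: "pos_semidef D" and x: "x \<bullet> (D *v x) = 0"
  shows "D *v x = 0"
proof (rule ccontr)
  assume nz: "D *v x \<noteq> 0"
  define y where "y = D *v x"
  define a where "a = y \<bullet> y"
  define c where "c = y \<bullet> (D *v y)"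
  have a: "a > 0" using nz by (simp add: a_def y_def)
  have c: "c \<ge> 0" using D by (simp add: c_def pos_semidef_def)
  have "x v* D = y"
    using D transpose_matrix_vector[of D x] by (simp add: y_def pos_semidef_def sym_mats_def)
  then have sym: "x \<bullet> (D *v y) = a"
    by (simp add: a_def flip: dot_lmul_matrix)
  define u where "u = a / (c + 1)"
  define t where "t = - u"
  have u: "u > 0" and a_eq: "a = u * (c + 1)"
    using a c by (auto simp: u_def)
  have "0 \<le> (x + t *\<^sub>R y) \<bullet> (D *v (x + t *\<^sub>R y))"
    using D by (simp add: pos_semidef_def)
  also have "\<dots> = 2 * t * a + t\<^sup>2 * c"
    using x sym by (simp add: matrix_vector_right_distrib matrix_vector_mult_scaleR inner_add_left
        inner_add_right y_def[symmetric] a_def[symmetric] c_def[symmetric] power2_eq_square algebra_simps)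
  also have "\<dots> = - (u\<^sup>2 * (c + 2))"
    by (simp add: t_def a_eq power2_eq_square algebra_simps)
  also have "\<dots> < 0"
    using u c by simp
  finally show False by simp
qed

text \<open>Testing with \<open>x x\<^sup>T + \<epsilon> I\<close> shows that \<open>D\<close> is semidefinite. Testing with
  \<open>A = (D + \<epsilon> I)\<^sup>-\<^sup>1\<close>, for which \<open>trace(D A) = n - \<epsilon> trace A \<le> n\<close>, gives \<open>\<gamma> \<le> det(D + \<epsilon> I)\<close>. The
  limit \<open>\<epsilon> \<rightarrow> 0\<close> bounds \<open>det D\<close>, and a semidefinite matrix with nonzero determinant is definite.\<close>
lemma pos_def_and_det_ge_if_trace_ge:
  fixes D :: "real ^ 'n ^ 'n"
  assumes D: "D \<in> sym_mats" and \<gamma>: "\<gamma> > 0"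
    and le: "\<And>A. pos_def A \<Longrightarrow> real CARD('n) * root CARD('n) \<gamma> * root CARD('n) (det A) \<le> trace (D ** A)"
  shows "pos_def D" and "\<gamma> \<le> det D"
proof -
  let ?n = "CARD('n)"
  have trace_nonneg: "trace (D ** A) \<ge> 0" if A: "pos_def A" for A
  proof -
    have "0 \<le> real ?n * root ?n \<gamma> * root ?n (det A)"
      using \<gamma> det_pos_def[OF A] by simp
    also have "\<dots> \<le> trace (D ** A)" by (rule le[OF A])
    finally show ?thesis .
  qed
  have psd: "pos_semidef D"
    unfolding pos_semidef_def
  proof (intro conjI allI D)
    fix x
    have "((\<lambda>\<epsilon>. x \<bullet> (D *v x) + \<epsilon> * trace D) \<longlongrightarrow> x \<bullet> (D *v x) + 0 * trace D) (at_right 0)"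
      by (intro tendsto_intros)
    moreover have "\<forall>\<^sub>F \<epsilon> in at_right 0. 0 \<le> x \<bullet> (D *v x) + \<epsilon> * trace D"
      unfolding eventually_at_right_field
    proof (intro exI[of _ 1] conjI allI impI)
      fix \<epsilon> :: real assume "0 < \<epsilon>"
      from trace_nonneg[OF pos_semidef_add_scalar[OF pos_semidef_outer this]]
      show "0 \<le> x \<bullet> (D *v x) + \<epsilon> * trace D"
        by (simp add: matrix_add_ldistrib trace_add trace_mult_outer scalar_matrix_assoc[symmetric] matrix_scalar_ac trace_scaleR)
    qed simp
    ultimately show "0 \<le> x \<bullet> (D *v x)"
      by (auto dest!: tendsto_lowerbound)
  qed
  have det_shift: "\<gamma> \<le> det (D + \<epsilon> *\<^sub>R mat 1)" if \<epsilon>: "\<epsilon> > 0" for \<epsilon>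
  proof -
    \<comment> \<open>The shift by \<open>\<epsilon>\<close> makes the inverse available before \<open>D\<close> is known to be definite.\<close>
    define E where "E = D + \<epsilon> *\<^sub>R mat 1"
    have E: "pos_def E" unfolding E_def by (rule pos_semidef_add_scalar[OF psd \<epsilon>])
    obtain A where A: "pos_def A" "A ** E = mat 1" "E ** A = mat 1"
      using pos_def_inverse[OF E] .
    have "real ?n * root ?n \<gamma> * root ?n (det A) \<le> trace (D ** A)" by (rule le[OF A(1)])
    also have "D ** A = mat 1 - \<epsilon> *\<^sub>R A"
      using A(3) by (simp add: E_def matrix_mult_add_left scalar_matrix_assoc[symmetric] algebra_simps)
    also have "trace (mat 1 - \<epsilon> *\<^sub>R A) \<le> real ?n"
      using trace_pos_def[OF A(1)] \<epsilon> by (simp add: trace_sub trace_I trace_scaleR)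
    finally have "root ?n (\<gamma> * det A) \<le> root ?n 1"
      by (simp add: real_root_mult)
    then have "\<gamma> * det A \<le> 1" by (simp del: real_root_one)
    moreover have "det E * det A = 1" using arg_cong[OF A(3), of det] by (simp add: det_mul)
    ultimately have "\<gamma> * det A \<le> det E * det A" by simp
    then show ?thesis using det_pos_def[OF A(1)] by (simp add: E_def)
  qed
  obtain r where r: "\<And>t. det (D + t *\<^sub>R mat 1) = (\<Prod>i<?n. t + r i)"
    using det_hyperbolic D unfolding hyperbolic_on_def by fastforce
  have "((\<lambda>\<epsilon>. det (D + \<epsilon> *\<^sub>R mat 1)) \<longlongrightarrow> det (D + 0 *\<^sub>R mat 1)) (at_right 0)"
    unfolding r by (intro tendsto_intros)
  moreover have "\<forall>\<^sub>F \<epsilon> in at_right 0. \<gamma> \<le> det (D + \<epsilon> *\<^sub>R mat 1)"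
    unfolding eventually_at_right_field using det_shift by (intro exI[of _ 1]) auto
  ultimately show det: "\<gamma> \<le> det D"
    by (auto dest!: tendsto_lowerbound)
  show "pos_def D"
    unfolding pos_def_def
  proof (intro conjI D allI impI)
    fix x :: "real ^ 'n" assume x: "x \<noteq> 0"
    have "x \<bullet> (D *v x) \<noteq> 0"
    proof
      assume "x \<bullet> (D *v x) = 0"
      then have "D *v x = 0" by (rule pos_semidef_null_vector[OF psd])
      moreover have "invertible D" using det \<gamma> by (simp add: invertible_det_nz)
      ultimately show False
        using x matrix_left_invertible_ker[of D] invertible_left_inverse[of D] by blast
    qed
    then show "x \<bullet> (D *v x) > 0"
      using psd unfolding pos_semidef_def by (metis order_le_less)
  qed
qed

section \<open>Gradients on the symmetric matrices\<close>
lemma trace_mult_eq_inner: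
  fixes D :: "real ^ 'n ^ 'n"
  assumes "H \<in> sym_mats"
  shows "trace (D ** H) = H \<bullet> D"
proof -
  have sym: "H $ j $ i = H $ i $ j" for i j
    using assms by (metis (mono_tags, lifting) mem_Collect_eq sym_mats_def transpose_def vec_lambda_beta)
  show ?thesis
    by (simp add: trace_def matrix_matrix_mult_def inner_vec_def sym[symmetric] mult.commute) 
qed

lemma inner_transpose:
  fixes H D :: "real ^ 'n ^ 'n"
  shows "transpose H \<bullet> transpose D = H \<bullet> D"
  unfolding inner_vec_def transpose_def by (simp add: inner_vec_def) (rule sum.swap)

text \<open>The matrix \<open>R\<close> represents the derivative on the space of all matrices; its symmetric part
  represents the same functional on symmetric directions. Since the difference quotients within the
  symmetric matrices see only such directions, the two functionals are interchangeable there.\<close>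
lemma has_sym_gradient_exists:
  fixes f h :: "real ^ 'n ^ 'n \<Rightarrow> real"
  assumes B: "B \<in> sym_mats" and h: "h differentiable (at B)" and fh: "\<And>A. A \<in> sym_mats \<Longrightarrow> f A = h A"
  obtains D where "has_sym_gradient f D B"
proof -
  obtain h' where h': "(h has_derivative h') (at B)"
    using h unfolding differentiable_def by blast
  define R where "R = adjoint h' 1"
  have R: "h' H = H \<bullet> R" for H
    using adjoint_works[OF has_derivative_linear[OF h'], of H 1] by (simp add: R_def)
  define D where "D = (1 / 2) *\<^sub>R (R + transpose R)"
  have DS: "D \<in> sym_mats"
    by (simp add: D_def sym_mats_def transpose_def vec_eq_iff)
  have eq: "trace (D ** H) = h' H" if "H \<in> sym_mats" for H
    using that inner_transpose[of H R]
    by (simp add: trace_mult_eq_inner R D_def inner_add_right sym_mats_def)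
  have "bounded_linear (\<lambda>H. trace (D ** H))"
    unfolding linear_conv_bounded_linear[symmetric]
    by (intro linearI) (simp_all add: matrix_add_ldistrib trace_add scalar_matrix_assoc[symmetric] matrix_scalar_ac trace_scaleR)
  moreover have "(f has_derivative h') (at B within sym_mats)"
    by (rule has_derivative_transform[OF B fh has_derivative_at_withinI[OF h']])
  then have "((\<lambda>A. (1 / norm (A - B)) *\<^sub>R (f A - (f B + h' (A - B)))) \<longlongrightarrow> 0) (at B within sym_mats)"
    by (simp add: has_derivative_within)
  then have "((\<lambda>A. (1 / norm (A - B)) *\<^sub>R (f A - (f B + trace (D ** (A - B))))) \<longlongrightarrow> 0) (at B within sym_mats)"
    by (rule Lim_transform_eventually)
      (use B in \<open>auto simp: eventually_at_topological eq subspace_diff subspace_sym_mats intro!: exI[of _ UNIV]\<close>)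
  ultimately have "(f has_derivative (\<lambda>H. trace (D ** H))) (at B within sym_mats)"
    by (simp add: has_derivative_within)
  then show ?thesis
    using DS that by (simp add: has_sym_gradient_def)
qed

text \<open>Line derivatives at symmetric points in symmetric directions are unaffected by the restriction of
  the derivative to symmetric matrices, because the whole line is symmetric.\<close>
lemma has_sym_gradient_line:
  assumes D: "has_sym_gradient f D B" and B: "B \<in> sym_mats" and A: "A \<in> sym_mats"
  shows "((\<lambda>t. f (B + t *\<^sub>R A)) has_real_derivative trace (D ** A)) (at 0)"
proof -
  have S: "B + t *\<^sub>R A \<in> sym_mats" for t
    using A B by (simp add: subspace_add subspace_scale subspace_sym_mats)
  have "((\<lambda>t. B + t *\<^sub>R A) has_derivative (\<lambda>t. t *\<^sub>R A)) (at 0)"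
    by (auto intro!: derivative_eq_intros)
  moreover have "(f has_derivative (\<lambda>H. trace (D ** H))) (at (B + 0 *\<^sub>R A) within range (\<lambda>t. B + t *\<^sub>R A))"
    using D S by (auto simp: has_sym_gradient_def intro: has_derivative_subset)
  ultimately have "((\<lambda>t. f (B + t *\<^sub>R A)) has_derivative (\<lambda>t. trace (D ** (t *\<^sub>R A)))) (at 0)"
    using has_derivative_in_compose by blast
  then show ?thesis
    by (simp add: has_field_derivative_def scalar_matrix_assoc[symmetric] matrix_scalar_ac trace_scaleR mult_commute_abs)
qed

section \<open>Majorization of the determinant and the determinant of the gradient\<close>
theorem proposition12p4:
  fixes g :: "real ^ 'n ^ 'n \<Rightarrow> real" and N :: nat and \<gamma> :: real
  assumes "N \<ge> 1"
    and "garding_dirichlet N g"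
    and "\<gamma> > 0"
  shows "(\<forall>A::real ^ 'n ^ 'n. pos_def A \<longrightarrow>
            real CARD('n) * root CARD('n) \<gamma> * root CARD('n) (det A) \<le> root N (g A))
     \<longleftrightarrow>
         (\<forall>B\<in>garding_cone g.
            pos_def (sym_gradient (\<lambda>A. root N (g A)) B) \<and>
            \<gamma> \<le> det (sym_gradient (\<lambda>A. root N (g A)) B))"
proof -
  let ?f = "\<lambda>A. root N (g A)" and ?n = "CARD('n)"
  let ?grad = "sym_gradient ?f"
  note N = assms(1) and gd = assms(2) and \<gamma> = assms(3)
  have hg: "homogeneous_poly_on sym_mats N g"
    using gd by (simp add: garding_dirichlet_def homogeneous_poly_on_sym_iff)
  note hyp = garding_dirichlet_hyperbolic[OF gd]
  note cone = garding_cone_eq_hyperbolicity_cone[OF gd]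
  have in_cone: "B \<in> sym_mats" "g B > 0" if "B \<in> garding_cone g" for B
    using that unfolding cone hyperbolicity_cone_def by (auto dest: spec[of _ 0])
  have grad: "has_sym_gradient ?f (?grad B) B" if B: "B \<in> garding_cone g" for B
  proof -
    obtain p where p: "real_polynomial_function p" "\<And>A. A \<in> sym_mats \<Longrightarrow> g A = p A"
      using hg unfolding homogeneous_poly_on_def by blast
    have "p differentiable (at B)"
      by (rule differentiable_at_real_polynomial_function[OF p(1)])
    moreover have "root N differentiable (at (p B))"
      using DERIV_real_root[of N "p B"] in_cone[OF B] p(2) N
      by (intro field_differentiable_imp_differentiable) (auto simp: field_differentiable_def)
    ultimately have "(\<lambda>A. root N (p A)) differentiable (at B)"
      using differentiable_chain_at[of p B "root N"] by (simp add: o_def)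
    then obtain D where D: "has_sym_gradient ?f D B"
      using has_sym_gradient_exists[OF in_cone(1)[OF B], of "\<lambda>A. root N (p A)" ?f] p(2) by force
    then show ?thesis
      by (simp add: sym_gradient_eqI[OF in_cone(1)[OF B] D])
  qed
  have tangent: "?f A \<le> trace (?grad B ** A)" if A: "pos_def A" and B: "B \<in> garding_cone g" for A B
  proof (rule hyperbolic_root_le_derivative[OF N subspace_sym_mats hg])
    have BK: "B \<in> hyperbolicity_cone sym_mats g (mat 1)" using B by (simp add: cone)
    show "hyperbolic_on sym_mats N g B"
      by (rule hyperbolic_on_cone[OF subspace_sym_mats hg hyp BK])
    show "A \<in> hyperbolicity_cone sym_mats g B"
      using pos_def_in_garding_cone[OF gd A]
      by (simp add: cone hyperbolicity_cone_eq[OF subspace_sym_mats hg hyp BK])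
    show "((\<lambda>t. ?f (B + t *\<^sub>R A)) has_real_derivative trace (?grad B ** A)) (at 0)"
      using has_sym_gradient_line[OF grad[OF B] in_cone(1)[OF B]] A by (simp add: pos_def_def)
  qed
  have euler: "trace (?grad B ** B) = ?f B" if B: "B \<in> garding_cone g" for B
  proof -
    \<comment> \<open>On the ray through \<open>B\<close> homogeneity makes the root of \<open>g\<close> affine in \<open>t\<close>, as long as
      \<open>1 + t\<close> stays positive.\<close>
    have "?f (B + t *\<^sub>R B) = (1 + t) * ?f B" if "t > -1" for t
    proof -
      have "?f (B + t *\<^sub>R B) = root N ((1 + t) ^ N * g B)"
        using homogeneous_poly_scale[OF hg in_cone(1)[OF B], of "1 + t"] by (simp add: scaleR_add_left)
      then show ?thesis
        using N that by (simp add: real_root_mult real_root_power_cancel)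
    qed
    then have "\<forall>\<^sub>F t in nhds 0. ?f (B + t *\<^sub>R B) = (1 + t) * ?f B"
      by (intro eventually_nhds_in_open[of "{-1<..}", THEN eventually_mono]) auto
    moreover have "((\<lambda>t. (1 + t) * ?f B) has_real_derivative ?f B) (at 0)"
      by (auto intro!: derivative_eq_intros)
    ultimately have "((\<lambda>t. ?f (B + t *\<^sub>R B)) has_real_derivative ?f B) (at 0)"
      using DERIV_cong_ev[OF refl _ refl] by fast
    then show ?thesis
      using has_sym_gradient_line[OF grad[OF B] in_cone(1)[OF B] in_cone(1)[OF B]] DERIV_unique by blast
  qed
  show ?thesis
  proof
    assume major: "\<forall>A::real ^ 'n ^ 'n. pos_def A \<longrightarrow>
        real ?n * root ?n \<gamma> * root ?n (det A) \<le> ?f A"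
    show "\<forall>B\<in>garding_cone g. pos_def (?grad B) \<and> \<gamma> \<le> det (?grad B)"
    proof
      fix B assume B: "B \<in> garding_cone g"
      have "?grad B \<in> sym_mats" using grad[OF B] by (simp add: has_sym_gradient_def)
      moreover have "real ?n * root ?n \<gamma> * root ?n (det A) \<le> trace (?grad B ** A)" if "pos_def A" for A
        using major that tangent[OF that B] by (meson order_trans)
      ultimately show "pos_def (?grad B) \<and> \<gamma> \<le> det (?grad B)"
        using pos_def_and_det_ge_if_trace_ge[OF _ \<gamma>] by blast
    qed
  next
    assume lower: "\<forall>B\<in>garding_cone g. pos_def (?grad B) \<and> \<gamma> \<le> det (?grad B)"
    show "\<forall>A::real ^ 'n ^ 'n. pos_def A \<longrightarrow> real ?n * root ?n \<gamma> * root ?n (det A) \<le> ?f A"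
    proof (intro allI impI)
      fix A :: "real ^ 'n ^ 'n" assume A: "pos_def A"
      have AK: "A \<in> garding_cone g" by (rule pos_def_in_garding_cone[OF gd A])
      have D: "pos_def (?grad A)" "\<gamma> \<le> det (?grad A)" using lower AK by auto
      have "real ?n * root ?n \<gamma> * root ?n (det A) \<le> real ?n * root ?n (det (?grad A)) * root ?n (det A)"
        using D(2) det_pos_def[OF A] by (intro mult_right_mono mult_left_mono) auto
      also have "\<dots> \<le> trace (?grad A ** A)"
        by (rule trace_det_arith_geom_mean[OF A D(1)])
      also have "\<dots> = ?f A" by (rule euler[OF AK])
      finally show "real ?n * root ?n \<gamma> * root ?n (det A) \<le> ?f A" .
    qed
  qed
qed

end
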